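(* Let $A=(a_1,b_1,c_1,d_1)$ and $B=(a_2,b_2,c_2,d_2)$ be real matrix parameters with $a_1d_1-b_1c_1=1$, $a_2d_2-b_2c_2=1$, $b_1\neq0$, $b_2\neq0$. Let $f,g\in L^2(\mathbb{R})$ be nonzero such that $uL_A^f(u),\,uL_B^f(u),\,uL_A^g(u),\,uL_B^g(u)\in L^2(\mathbb{R})$. Then the frequency spreads of the STLCTs $S^A_gf$ and $S^B_gf$ satisfy $$F^2_{A,S}\,F^2_{B,S}\ \ge\ \frac{(a_1b_2-a_2b_1)^2}{4}.$$
   Context: For a real matrix parameter $M=(a,b,c,d)$ with $ad-bc=1$ and $b\neq0$, the LCT of $h\in L^2(\mathbb{R})$ is $L_M^{h}(u)=\int h(t)K_M(t,u)\,dt$ with $K_M(t,u)=\frac{1}{\sqrt{i2\pi b}}\exp\!\big(i\frac{a}{2b}t^2-i\frac{1}{b}tu+i\frac{d}{2b}u^2\big)$. For a window $g\in L^2(\mathbb{R})$, the STLCT of $f$ with parameter $M$ is $S^{M}_{g}f(t,u)=\int f(\tau)\overline{g(\tau-t)}K_M(\tau,u)\,d\tau$. With $\|S\|^2=\iint|S^M_gf(t,u)|^2dt\,du$, the mean frequency is $\overline{u_{M,S}}=\frac{1}{\|S\|^2}\iint u|S^M_gf(t,u)|^2dt\,du$ and the frequency spread is $F^2_{M,S}=\frac{1}{\|S\|^2}\iint (u-\overline{u_{M,S}})^2|S^M_gf(t,u)|^2dt\,du$. *)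

theory Defs
  imports "HOL-Analysis.Analysis"
begin

type_synonym lct_param = "real \<times> real \<times> real \<times> real"  (* (a,b,c,d) *)

definition valid_param :: "lct_param \<Rightarrow> bool" where
  "valid_param M = (case M of (a,b,c,d) \<Rightarrow> a*d - b*c = 1 \<and> b \<noteq> 0)"

definition square_integrable :: "(real \<Rightarrow> complex) \<Rightarrow> bool" where
  "square_integrable h \<longleftrightarrow> h \<in> borel_measurable lborel \<and> integrable lborel (\<lambda>x. (cmod (h x))\<^sup>2)"

definition lct_kernel :: "lct_param \<Rightarrow> real \<Rightarrow> real \<Rightarrow> complex" where
  "lct_kernel M t u = (case M of (a,b,c,d) \<Rightarrow>
     (1 / csqrt (\<i> * 2 * complex_of_real pi * complex_of_real b)) *
     exp (\<i> * complex_of_real (a/(2*b) * t\<^sup>2 - t*u/b + d/(2*b) * u\<^sup>2)))"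

text \<open>Truncated LCT integral over [-R,R] (absolutely convergent for L2 functions).\<close>
definition lct_trunc :: "lct_param \<Rightarrow> (real \<Rightarrow> complex) \<Rightarrow> real \<Rightarrow> real \<Rightarrow> complex" where
  "lct_trunc M h R u = (LINT t:{-R..R}|lborel. h t * lct_kernel M t u)"

text \<open>F is (a representative of) the LCT of h in L2: the L2-limit of the truncated integrals.\<close>
definition is_lct :: "lct_param \<Rightarrow> (real \<Rightarrow> complex) \<Rightarrow> (real \<Rightarrow> complex) \<Rightarrow> bool" where
  "is_lct M h F \<longleftrightarrow> square_integrable F \<and>
     ((\<lambda>R. \<integral>\<^sup>+ u. ennreal ((cmod (F u - lct_trunc M h R u))\<^sup>2) \<partial>lborel) \<longlongrightarrow> 0) at_top"

definition stlct :: "lct_param \<Rightarrow> (real \<Rightarrow> complex) \<Rightarrow> (real \<Rightarrow> complex) \<Rightarrow> real \<Rightarrow> real \<Rightarrow> complex" where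
  "stlct M g f t u = (LINT \<tau>|lborel. f \<tau> * cnj (g (\<tau> - t)) * lct_kernel M \<tau> u)"

definition stlct_norm2 :: "lct_param \<Rightarrow> (real \<Rightarrow> complex) \<Rightarrow> (real \<Rightarrow> complex) \<Rightarrow> real" where
  "stlct_norm2 M g f = enn2real (\<integral>\<^sup>+ p. ennreal ((cmod (stlct M g f (fst p) (snd p)))\<^sup>2) \<partial>(lborel \<Otimes>\<^sub>M lborel))"

definition mean_freq :: "lct_param \<Rightarrow> (real \<Rightarrow> complex) \<Rightarrow> (real \<Rightarrow> complex) \<Rightarrow> real" where
  "mean_freq M g f = (1 / stlct_norm2 M g f) *
     (\<integral> p. snd p * (cmod (stlct M g f (fst p) (snd p)))\<^sup>2 \<partial>(lborel \<Otimes>\<^sub>M lborel))"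

definition freq_spread :: "lct_param \<Rightarrow> (real \<Rightarrow> complex) \<Rightarrow> (real \<Rightarrow> complex) \<Rightarrow> ennreal" where
  "freq_spread M g f = ennreal (1 / stlct_norm2 M g f) *
     (\<integral>\<^sup>+ p. ennreal ((snd p - mean_freq M g f)\<^sup>2 * (cmod (stlct M g f (fst p) (snd p)))\<^sup>2)
        \<partial>(lborel \<Otimes>\<^sub>M lborel))"

end

theory Submission
  imports Defs "HOL-Probability.Characteristic_Functions"
begin

text \<open>
  For fixed \<open>t\<close> the short-time transform \<open>S(t, \<cdot>)\<close> is the LCT of the slice \<open>H(t, \<cdot>)\<close> of
  \<open>H(t,\<tau>) = f(\<tau>) cnj (g(\<tau> - t))\<close>, and Plancherel gives \<open>\<parallel>S\<parallel> = \<parallel>H\<parallel>\<close>. The LCT with parameter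
  \<open>(a,b,c,d)\<close> turns a unitary \<open>U\<^sub>s\<close>, a translation by \<open>s b\<close> followed by a modulation, into
  multiplication by \<open>exp (i s (u - m))\<close>; hence \<open>\<parallel>U\<^sub>s H - H\<parallel> \<le> \<bar>s\<bar> \<parallel>(u - m) S\<parallel>\<close>. The unitaries
  \<open>U\<^sub>s\<close> and \<open>V\<^sub>s\<close> belonging to \<open>A\<close> and \<open>B\<close> commute up to the phase \<open>exp (- i s\<^sup>2 D)\<close>, where
  \<open>D = a\<^sub>1 b\<^sub>2 - a\<^sub>2 b\<^sub>1\<close>, so that
  \<open>(exp (- i s\<^sup>2 D) - 1) \<langle>U\<^sub>s H, V\<^sub>-\<^sub>s H\<rangle>
    = \<langle>V\<^sub>s H - H, U\<^sub>-\<^sub>s H - H\<rangle> - \<langle>U\<^sub>s H - H, V\<^sub>-\<^sub>s H - H\<rangle>\<close>.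
  Cauchy--Schwarz on the right, division by \<open>s\<^sup>2\<close> and the limit \<open>s \<rightarrow> 0\<close> give
  \<open>\<bar>D\<bar> \<parallel>H\<parallel>\<^sup>2 \<le> 2 \<parallel>(u - m) S\<^sub>A\<parallel> \<parallel>(u - n) S\<^sub>B\<parallel>\<close> for all real \<open>m\<close>, \<open>n\<close>. Working with the unitaries
  instead of their generators avoids every question of differentiability and domains. Plancherel's
  theorem comes from integrating the Fourier transform of the autocorrelation against Gaussians of
  growing width.
\<close>

section \<open>Translations\<close>

lemma integral_shift:
  fixes c :: "'a :: euclidean_space" and f :: "'a \<Rightarrow> 'b :: {banach, second_countable_topology}"
  assumes [measurable]: "f \<in> borel_measurable borel"
  shows "(\<integral>x. f (x + c) \<partial>lborel) = (\<integral>x. f x \<partial>lborel)"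
proof -
  have "(\<integral>x. f x \<partial>lborel) = (\<integral>x. f x \<partial>distr lborel borel ((+) c))"
    by (simp add: lborel_distr_plus)
  also have "\<dots> = (\<integral>x. f (c + x) \<partial>lborel)"
    by (subst integral_distr) auto
  finally show ?thesis by (simp add: add.commute)
qed

lemma integrable_shift:
  fixes c :: "'a :: euclidean_space" and f :: "'a \<Rightarrow> 'b :: {banach, second_countable_topology}"
  assumes "integrable lborel f"
  shows "integrable lborel (\<lambda>x. f (x + c))"
proof -
  have "integrable (distr lborel borel ((+) c)) f"
    using assms by (simp add: lborel_distr_plus)
  then show ?thesis
    using assms by (subst (asm) integrable_distr_eq) (auto simp: add.commute)
qed

definition translation_dist ::
    "('a::euclidean_space \<Rightarrow> 'b::{banach, second_countable_topology}) \<Rightarrow> 'a \<Rightarrow> real" where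
  "translation_dist f z = (\<integral>x. norm (f (x + z) - f x) \<partial>lborel)"

lemma translation_dist_nonneg: "0 \<le> translation_dist f z"
  by (simp add: translation_dist_def)

lemma translation_dist_le:
  assumes "integrable lborel f"
  shows "translation_dist f z \<le> 2 * (\<integral>x. norm (f x) \<partial>lborel)"
proof -
  note shifted = integrable_shift[OF assms, of z]
  have "translation_dist f z \<le> (\<integral>x. norm (f (x + z)) + norm (f x) \<partial>lborel)"
    unfolding translation_dist_def
    using assms shifted by (intro integral_mono) (auto intro: norm_triangle_ineq4)
  also have "\<dots> = 2 * (\<integral>x. norm (f x) \<partial>lborel)"
    using assms shifted integral_shift[of "\<lambda>x. norm (f x)" z] by simp
  finally show ?thesis .
qed

lemma translation_dist_add:
  assumes "integrable lborel f" "integrable lborel g"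
  shows "translation_dist (\<lambda>x. f x + g x) z \<le> translation_dist f z + translation_dist g z"
proof -
  have diffs: "integrable lborel (\<lambda>x. f (x + z) - f x)" "integrable lborel (\<lambda>x. g (x + z) - g x)"
    using assms integrable_shift[OF assms(1), of z] integrable_shift[OF assms(2), of z] by auto
  have "translation_dist (\<lambda>x. f x + g x) z
      \<le> (\<integral>x. norm (f (x + z) - f x) + norm (g (x + z) - g x) \<partial>lborel)"
    unfolding translation_dist_def
    using Bochner_Integration.integrable_add[OF diffs] diffs
    by (intro integral_mono) (auto simp: algebra_simps intro: norm_diff_triangle_ineq)
  also have "\<dots> = translation_dist f z + translation_dist g z"
    using diffs by (simp add: translation_dist_def)
  finally show ?thesis .
qed

lemma translation_dist_tendsto_0_approx:
  assumes f: "integrable lborel f"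
    and approx: "\<And>e. 0 < e \<Longrightarrow> \<exists>g. integrable lborel g \<and> (translation_dist g \<longlongrightarrow> 0) (at 0)
      \<and> (\<integral>x. norm (f x - g x) \<partial>lborel) < e"
  shows "(translation_dist f \<longlongrightarrow> 0) (at 0)"
proof (rule tendstoI)
  fix e :: real assume "0 < e"
  then obtain g where g: "integrable lborel g" "(translation_dist g \<longlongrightarrow> 0) (at 0)"
      "(\<integral>x. norm (f x - g x) \<partial>lborel) < e / 4"
    using approx[of "e / 4"] by auto
  have bound: "translation_dist f z
      \<le> translation_dist g z + 2 * (\<integral>x. norm (f x - g x) \<partial>lborel)" for z
    using translation_dist_add[OF g(1), of "\<lambda>x. f x - g x" z]
      translation_dist_le[of "\<lambda>x. f x - g x" z] f g(1) by simp
  have "translation_dist f z < e" if "translation_dist g z < e / 2" for z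
    using that g(3) bound[of z] by linarith
  moreover have "eventually (\<lambda>z. translation_dist g z < e / 2) (at 0)"
    using order_tendstoD(2)[OF g(2), of "e / 2"] \<open>0 < e\<close> by simp
  ultimately show "eventually (\<lambda>z. dist (translation_dist f z) 0 < e) (at 0)"
    by (auto simp: translation_dist_nonneg elim: eventually_mono)
qed

lemma translation_dist_indicator:
  fixes A :: "'a::euclidean_space set"
  assumes [measurable]: "A \<in> sets borel" and fin: "emeasure lborel A < \<infinity>"
  shows "translation_dist (\<lambda>x. indicator A x *\<^sub>R c) z
    = norm c * (2 * (\<integral>x. indicat_real A x * (1 - indicat_real A (x + z)) \<partial>lborel))"
proof -
  let ?leave = "\<lambda>x. indicat_real A x * (1 - indicat_real A (x + z))"
  have A: "integrable lborel (indicat_real A)"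
    using fin by auto
  have leave: "integrable lborel ?leave"
    by (rule Bochner_Integration.integrable_bound[OF A]) (auto split: split_indicator)
  have "translation_dist (\<lambda>x. indicator A x *\<^sub>R c) z
      = (\<integral>x. norm c * (2 * ?leave x + (indicat_real A (x + z) - indicat_real A x)) \<partial>lborel)"
    unfolding translation_dist_def
    by (intro Bochner_Integration.integral_cong) (auto split: split_indicator)
  also have "\<dots> = norm c * (2 * (\<integral>x. ?leave x \<partial>lborel))"
    using A integrable_shift[OF A] leave integral_shift[of "indicat_real A" z] by simp
  finally show ?thesis .
qed

lemma translation_dist_tendsto_0_open:
  fixes U :: "'a::euclidean_space set"
  assumes "open U" and fin: "emeasure lborel U < \<infinity>"
  shows "(translation_dist (\<lambda>x. indicator U x *\<^sub>R c) \<longlongrightarrow> 0) (at 0)"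
  unfolding tendsto_at_iff_sequentially o_def
proof (intro allI impI)
  fix z :: "nat \<Rightarrow> 'a" assume z: "z \<longlonglongrightarrow> 0"
  have U_borel [measurable]: "U \<in> sets borel"
    using \<open>open U\<close> by auto
  let ?leave = "\<lambda>n x. indicat_real U x * (1 - indicat_real U (x + z n))"
  have "(\<lambda>n. \<integral>x. ?leave n x \<partial>lborel) \<longlonglongrightarrow> (\<integral>x. 0 \<partial>(lborel :: 'a measure))"
  proof (rule integral_dominated_convergence[where w = "indicat_real U"])
    show "integrable lborel (indicat_real U)"
      using fin by auto
    show "AE x in lborel. (\<lambda>n. ?leave n x) \<longlonglongrightarrow> 0"
    proof (intro AE_I2)
      fix x :: 'a
      have "(\<lambda>n. x + z n) \<longlonglongrightarrow> x"
        using tendsto_add[OF tendsto_const z] by simp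
      then have "eventually (\<lambda>n. x + z n \<in> U) sequentially" if "x \<in> U"
        using that \<open>open U\<close> by (auto dest: topological_tendstoD)
      then show "(\<lambda>n. ?leave n x) \<longlonglongrightarrow> 0"
        by (cases "x \<in> U") (auto intro!: tendsto_eventually elim!: eventually_mono)
    qed
  qed (auto split: split_indicator)
  then have "(\<lambda>n. norm c * (2 * (\<integral>x. ?leave n x \<partial>lborel))) \<longlonglongrightarrow> norm c * (2 * 0)"
    by (intro tendsto_intros) simp
  then show "(\<lambda>n. translation_dist (\<lambda>x. indicator U x *\<^sub>R c) (z n)) \<longlonglongrightarrow> 0"
    by (simp add: translation_dist_indicator[OF U_borel fin])
qed

lemma translation_dist_tendsto_0_indicator:
  fixes A :: "'a::euclidean_space set"
  assumes A: "A \<in> sets borel" "emeasure lborel A < \<infinity>"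
  shows "(translation_dist (\<lambda>x. indicator A x *\<^sub>R c) \<longlongrightarrow> 0) (at 0)"
proof (rule translation_dist_tendsto_0_approx)
  show "integrable lborel (\<lambda>x. indicator A x *\<^sub>R c)"
    using A by auto
  fix e :: real assume e: "0 < e"
  define d where "d = e / (norm c + 1)"
  have "0 < norm c + 1"
    by (simp add: add_nonneg_pos)
  then have d: "0 < d" "norm c * d < e"
    using e by (auto simp: d_def pos_divide_less_eq distrib_left mult.commute)
  obtain U where U: "open U" "A \<subseteq> U" "emeasure lborel (U - A) < ennreal d"
    using outer_regular_lborel[OF A(1) d(1)] by blast
  have [measurable]: "U \<in> sets borel" "A \<in> sets borel"
    using U A by auto
  have "emeasure lborel U \<le> emeasure lborel A + emeasure lborel (U - A)"
    using emeasure_subadditive[of A lborel "U - A"] U(2) by (simp add: Un_absorb1)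
  also have "\<dots> < \<infinity>"
    using A(2) order.strict_trans[OF U(3) ennreal_less_top] by simp
  finally have fin: "emeasure lborel U < \<infinity>" .
  have "(\<integral>x. norm (indicator A x *\<^sub>R c - indicator U x *\<^sub>R c) \<partial>lborel)
      = (\<integral>x. norm c * indicat_real (U - A) x \<partial>lborel)"
    using U(2) by (intro Bochner_Integration.integral_cong) (auto split: split_indicator)
  also have "\<dots> = norm c * measure lborel (U - A)"
    by simp
  also have "\<dots> \<le> norm c * d"
    using U(3) d(1) by (intro mult_left_mono) (auto simp: measure_def enn2real_leI less_imp_le)
  finally have "(\<integral>x. norm (indicator A x *\<^sub>R c - indicator U x *\<^sub>R c) \<partial>lborel) < e"
    using d(2) by simp
  then show "\<exists>g. integrable lborel g \<and> (translation_dist g \<longlongrightarrow> 0) (at 0)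
      \<and> (\<integral>x. norm (indicator A x *\<^sub>R c - g x) \<partial>lborel) < e"
    using translation_dist_tendsto_0_open[OF U(1) fin] fin
    by (intro exI[of _ "\<lambda>x. indicator U x *\<^sub>R c"]) auto
qed

theorem translation_dist_tendsto_0:
  fixes f :: "'a::euclidean_space \<Rightarrow> 'b::{banach, second_countable_topology}"
  assumes "integrable lborel f"
  shows "(translation_dist f \<longlongrightarrow> 0) (at 0)"
  using assms
proof (induction rule: integrable_induct)
  case (base A c)
  then show ?case
    by (intro translation_dist_tendsto_0_indicator) auto
next
  case (add f g)
  show ?case
  proof (rule tendsto_sandwich[OF _ _ tendsto_const])
    show "((\<lambda>z. translation_dist f z + translation_dist g z) \<longlongrightarrow> 0) (at 0)"
      using tendsto_add[OF add.IH] by simp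
  qed (auto intro!: always_eventually translation_dist_nonneg translation_dist_add add.hyps)
next
  case (lim f s)
  have [measurable]: "f \<in> borel_measurable lborel" "s i \<in> borel_measurable lborel" for i
    using lim.hyps by auto
  show ?case
  proof (rule translation_dist_tendsto_0_approx[OF \<open>integrable lborel f\<close>])
    fix e :: real assume "0 < e"
    have "(\<lambda>i. \<integral>x. norm (f x - s i x) \<partial>lborel) \<longlonglongrightarrow> (\<integral>x. 0 \<partial>(lborel :: 'a measure))"
    proof (rule integral_dominated_convergence[where w = "\<lambda>x. 3 * norm (f x)"])
      show "AE x in lborel. (\<lambda>i. norm (f x - s i x)) \<longlonglongrightarrow> 0"
        using lim.hyps(2) by (auto intro!: AE_I2 tendsto_eq_intros)
      show "AE x in lborel. norm (norm (f x - s i x)) \<le> 3 * norm (f x)" for i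
        using lim.hyps(3) norm_triangle_ineq4[of "f _" "s i _"]
        by (fastforce intro!: AE_I2 elim: order_trans)
    qed (use lim.hyps(4) in auto)
    then have "eventually (\<lambda>i. (\<integral>x. norm (f x - s i x) \<partial>lborel) < e) sequentially"
      using \<open>0 < e\<close> by (intro order_tendstoD(2)) auto
    then show "\<exists>g. integrable lborel g \<and> (translation_dist g \<longlongrightarrow> 0) (at 0)
        \<and> (\<integral>x. norm (f x - g x) \<partial>lborel) < e"
      using lim.hyps(1) lim.IH by (auto simp: eventually_sequentially)
  qed
qed

section \<open>Square-integrable functions\<close>

definition L2 :: "'a measure \<Rightarrow> ('a \<Rightarrow> complex) set" where
  "L2 M = {x \<in> borel_measurable M. integrable M (\<lambda>p. (cmod (x p))\<^sup>2)}"

definition L2_inner :: "'a measure \<Rightarrow> ('a \<Rightarrow> complex) \<Rightarrow> ('a \<Rightarrow> complex) \<Rightarrow> complex" where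
  "L2_inner M x y = (\<integral>p. x p * cnj (y p) \<partial>M)"

definition L2_norm :: "'a measure \<Rightarrow> ('a \<Rightarrow> complex) \<Rightarrow> real" where
  "L2_norm M x = sqrt (\<integral>p. (cmod (x p))\<^sup>2 \<partial>M)"

lemma L2_measurable [measurable_dest]: "x \<in> L2 M \<Longrightarrow> x \<in> borel_measurable M"
  by (simp add: L2_def)

lemma L2_lborel_measurable [measurable_dest]: "x \<in> L2 lborel \<Longrightarrow> x \<in> borel_measurable borel"
  using L2_measurable[of x lborel] by simp

lemma L2_integrable_power2: "x \<in> L2 M \<Longrightarrow> integrable M (\<lambda>p. (cmod (x p))\<^sup>2)"
  by (simp add: L2_def)

lemma L2_iff_nn_integral_finite:
  "x \<in> L2 M \<longleftrightarrow> x \<in> borel_measurable M \<and> (\<integral>\<^sup>+p. ennreal ((cmod (x p))\<^sup>2) \<partial>M) < \<infinity>"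
  by (auto simp: L2_def integrable_iff_bounded)

lemma L2_norm_nonneg: "0 \<le> L2_norm M x"
  by (simp add: L2_norm_def)

lemma power2_L2_norm: "(L2_norm M x)\<^sup>2 = (\<integral>p. (cmod (x p))\<^sup>2 \<partial>M)"
  by (simp add: L2_norm_def)

lemma nn_integral_eq_L2_norm:
  assumes "x \<in> L2 M"
  shows "(\<integral>\<^sup>+p. ennreal ((cmod (x p))\<^sup>2) \<partial>M) = ennreal ((L2_norm M x)\<^sup>2)"
  using assms by (simp add: power2_L2_norm L2_integrable_power2 nn_integral_eq_integral)

lemma L2_norm_pos:
  assumes "x \<in> L2 M" "\<not> (AE p in M. x p = 0)"
  shows "0 < L2_norm M x"
proof -
  have "(\<integral>p. (cmod (x p))\<^sup>2 \<partial>M) \<noteq> 0"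
    using assms by (simp add: integral_nonneg_eq_0_iff_AE L2_integrable_power2)
  then show ?thesis
    using L2_norm_nonneg[of M x] by (auto simp: L2_norm_def less_le)
qed

lemma L2_inner_self: "L2_inner M x x = complex_of_real ((L2_norm M x)\<^sup>2)"
  by (simp only: L2_inner_def power2_L2_norm complex_norm_square[symmetric] integral_complex_of_real)

lemma borel_measurable_cnj [measurable]: "cnj \<in> borel_measurable borel"
  by (intro borel_measurable_continuous_onI continuous_intros)

lemma L2_diff:
  assumes "x \<in> L2 M" "y \<in> L2 M"
  shows "(\<lambda>p. x p - y p) \<in> L2 M"
proof -
  note [measurable] = assms
  have "(cmod (x p - y p))\<^sup>2 \<le> 2 * (cmod (x p))\<^sup>2 + 2 * (cmod (y p))\<^sup>2" for p
    using power_mono[OF norm_triangle_ineq4[of "x p" "y p"], of 2]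
      sum_squares_bound[of "cmod (x p)" "cmod (y p)"] by (simp add: power2_sum)
  then have "integrable M (\<lambda>p. (cmod (x p - y p))\<^sup>2)"
    using assms[THEN L2_integrable_power2]
    by - (rule Bochner_Integration.integrable_bound
        [of _ "\<lambda>p. 2 * (cmod (x p))\<^sup>2 + 2 * (cmod (y p))\<^sup>2"]; simp)
  then show ?thesis
    by (simp add: L2_def)
qed

lemma integrable_L2_mult_cnj:
  assumes "x \<in> L2 M" "y \<in> L2 M"
  shows "integrable M (\<lambda>p. x p * cnj (y p))"
proof -
  note [measurable] = assms
  have "cmod (x p * cnj (y p)) \<le> (cmod (x p))\<^sup>2 + (cmod (y p))\<^sup>2" for p
    using sum_squares_bound[of "cmod (x p)" "cmod (y p)"]
      mult_nonneg_nonneg[OF norm_ge_zero[of "x p"] norm_ge_zero[of "y p"]]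
    unfolding norm_mult complex_mod_cnj by linarith
  then show ?thesis
    using assms[THEN L2_integrable_power2]
    by - (rule Bochner_Integration.integrable_bound
        [of _ "\<lambda>p. (cmod (x p))\<^sup>2 + (cmod (y p))\<^sup>2"]; simp)
qed

lemma
  assumes "x \<in> L2 M" "y \<in> L2 M" "z \<in> L2 M"
  shows L2_inner_diff_left: "L2_inner M (\<lambda>p. x p - y p) z = L2_inner M x z - L2_inner M y z"
    and L2_inner_diff_right: "L2_inner M z (\<lambda>p. x p - y p) = L2_inner M z x - L2_inner M z y"
  using assms
  by (simp_all add: L2_inner_def left_diff_distrib right_diff_distrib integrable_L2_mult_cnj
      Bochner_Integration.integral_diff)

theorem L2_Cauchy_Schwarz:
  assumes "x \<in> L2 M" "y \<in> L2 M"
  shows "cmod (L2_inner M x y) \<le> L2_norm M x * L2_norm M y"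
proof -
  note [measurable] = assms
  have integrable_prod: "integrable M (\<lambda>p. cmod (x p) * cmod (y p))"
    using integrable_norm[OF integrable_L2_mult_cnj[OF assms]] by (simp add: norm_mult)
  have "ennreal ((\<integral>p. cmod (x p) * cmod (y p) \<partial>M)\<^sup>2)
      = (\<integral>\<^sup>+p. ennreal (cmod (x p)) * ennreal (cmod (y p)) \<partial>M)\<^sup>2"
    using nn_integral_eq_integral[OF integrable_prod] by (simp add: ennreal_mult ennreal_power)
  also have "\<dots> \<le> (\<integral>\<^sup>+p. (ennreal (cmod (x p)))\<^sup>2 \<partial>M) * (\<integral>\<^sup>+p. (ennreal (cmod (y p)))\<^sup>2 \<partial>M)"
    by (rule Cauchy_Schwarz_nn_integral) auto
  also have "\<dots> = ennreal ((L2_norm M x * L2_norm M y)\<^sup>2)"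
    using assms[THEN nn_integral_eq_L2_norm]
    by (simp add: ennreal_power power_mult_distrib ennreal_mult)
  finally have "(\<integral>p. cmod (x p) * cmod (y p) \<partial>M)\<^sup>2 \<le> (L2_norm M x * L2_norm M y)\<^sup>2"
    by (subst (asm) ennreal_le_iff) auto
  then have "(\<integral>p. cmod (x p) * cmod (y p) \<partial>M) \<le> L2_norm M x * L2_norm M y"
    by (rule power2_le_imp_le) (simp add: L2_norm_nonneg)
  moreover have "cmod (L2_inner M x y) \<le> (\<integral>p. cmod (x p) * cmod (y p) \<partial>M)"
    using integral_norm_bound[of M "\<lambda>p. x p * cnj (y p)"] by (simp add: L2_inner_def norm_mult)
  ultimately show ?thesis by linarith
qed

lemma L2_inner_le:
  assumes "x \<in> L2 M" "y \<in> L2 M" "L2_norm M x \<le> \<delta>" "L2_norm M y \<le> \<epsilon>"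
  shows "cmod (L2_inner M x y) \<le> \<delta> * \<epsilon>"
  using L2_Cauchy_Schwarz[OF assms(1,2)] mult_mono[OF assms(3,4) _ L2_norm_nonneg]
    order_trans[OF L2_norm_nonneg assms(3)] by linarith

lemma L2_inner_perturbation_ge:
  assumes "x \<in> L2 M" "u \<in> L2 M" "y \<in> L2 M"
    and "L2_norm M (\<lambda>p. u p - x p) \<le> \<delta>" "L2_norm M (\<lambda>p. y p - x p) \<le> \<epsilon>"
    and "L2_norm M y = L2_norm M x"
  shows "(L2_norm M x)\<^sup>2 - (\<delta> + \<epsilon>) * L2_norm M x \<le> cmod (L2_inner M u y)"
proof -
  let ?N = "L2_norm M x" and ?P = "L2_inner M u y"
  let ?Q = "L2_inner M (\<lambda>p. u p - x p) y" and ?R = "L2_inner M x (\<lambda>p. y p - x p)"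
  have "complex_of_real (?N\<^sup>2) = ?P - ?Q - ?R"
    by (simp add: L2_inner_diff_left L2_inner_diff_right assms L2_inner_self)
  then have "?N\<^sup>2 = cmod (?P - ?Q - ?R)"
    by (metis abs_power2 norm_of_real)
  then have "?N\<^sup>2 \<le> cmod ?P + cmod ?Q + cmod ?R"
    using norm_triangle_ineq4[of "?P - ?Q" ?R] norm_triangle_ineq4[of ?P ?Q] by linarith
  moreover have "cmod ?Q \<le> \<delta> * ?N"
    by (intro L2_inner_le L2_diff assms) (simp add: assms)
  moreover have "cmod ?R \<le> ?N * \<epsilon>"
    by (intro L2_inner_le L2_diff assms) simp
  ultimately show ?thesis
    by (simp add: algebra_simps)
qed

lemma
  assumes "x \<in> L2 lborel"
  shows L2_shift: "(\<lambda>p. x (p + c)) \<in> L2 lborel"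
    and L2_norm_shift: "L2_norm lborel (\<lambda>p. x (p + c)) = L2_norm lborel x"
proof -
  have [measurable]: "x \<in> borel_measurable borel"
    by (rule L2_lborel_measurable[OF assms])
  show "(\<lambda>p. x (p + c)) \<in> L2 lborel"
    using integrable_shift[OF L2_integrable_power2[OF assms], of c] by (simp add: L2_def)
  show "L2_norm lborel (\<lambda>p. x (p + c)) = L2_norm lborel x"
    using integral_shift[of "\<lambda>p. (cmod (x p))\<^sup>2" c] by (simp add: L2_norm_def)
qed

lemma power2_norm_diff_le:
  fixes a b :: "'a::real_inner"
  shows "(norm (a - b))\<^sup>2 \<le> 2 * norm (norm a *\<^sub>R a - norm b *\<^sub>R b)"
proof (cases "a = b")
  case False
  let ?d = "norm a *\<^sub>R a - norm b *\<^sub>R b"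
  have "(norm (a - b))\<^sup>2 = (norm a)\<^sup>2 + (norm b)\<^sup>2 - 2 * (a \<bullet> b)"
    by (simp add: power2_norm_eq_inner inner_diff_left inner_diff_right inner_commute)
  moreover have "?d \<bullet> (a - b) = norm a * ((norm a)\<^sup>2 - a \<bullet> b) + norm b * ((norm b)\<^sup>2 - a \<bullet> b)"
    unfolding power2_norm_eq_inner
    by (simp add: inner_diff_left inner_diff_right inner_commute[of b a] right_diff_distrib)
  ultimately have "2 * (?d \<bullet> (a - b)) = (norm a + norm b) * ((norm (a - b))\<^sup>2 + (norm a - norm b)\<^sup>2)"
    by (simp only:) (simp add: power2_eq_square algebra_simps)
  then have "(norm a + norm b) * (norm (a - b))\<^sup>2 \<le> 2 * (?d \<bullet> (a - b))"
    by (simp add: distrib_left)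
  moreover have "norm (a - b) * (norm (a - b))\<^sup>2 \<le> (norm a + norm b) * (norm (a - b))\<^sup>2"
    by (intro mult_right_mono norm_triangle_ineq4) auto
  moreover have "?d \<bullet> (a - b) \<le> norm ?d * norm (a - b)"
    by (rule norm_cauchy_schwarz)
  ultimately have "norm (a - b) * (norm (a - b))\<^sup>2 \<le> norm (a - b) * (2 * norm ?d)"
    by (simp add: mult.commute)
  then show ?thesis
    using False by simp
qed simp

text \<open>The map \<open>a \<mapsto> \<bar>a\<bar> a\<close> reduces continuity of translations in \<open>L\<^sup>2\<close> to that in \<open>L\<^sup>1\<close>.\<close>

theorem L2_norm_translation_tendsto_0:
  assumes x: "x \<in> L2 lborel"
  shows "((\<lambda>z. L2_norm lborel (\<lambda>t. x (t + z) - x t)) \<longlongrightarrow> 0) (at 0)"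
proof -
  let ?y = "\<lambda>t. cmod (x t) *\<^sub>R x t"
  have [measurable]: "x \<in> borel_measurable borel"
    by (rule L2_lborel_measurable[OF x])
  have y: "integrable lborel ?y"
    by (rule Bochner_Integration.integrable_bound[OF L2_integrable_power2[OF x]])
       (auto simp: power2_eq_square)
  have bound: "(L2_norm lborel (\<lambda>t. x (t + z) - x t))\<^sup>2 \<le> 2 * translation_dist ?y z" for z
  proof -
    have "integrable lborel (\<lambda>t. 2 * norm (?y (t + z) - ?y t))"
      using Bochner_Integration.integrable_diff[OF integrable_shift[OF y, of z] y]
      by (intro integrable_mult_right integrable_norm)
    then have "(\<integral>t. (cmod (x (t + z) - x t))\<^sup>2 \<partial>lborel) \<le> (\<integral>t. 2 * norm (?y (t + z) - ?y t) \<partial>lborel)"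
      using L2_diff[OF L2_shift[OF x] x, of z, THEN L2_integrable_power2]
      by (intro integral_mono power2_norm_diff_le)
    then show ?thesis
      by (simp add: power2_L2_norm translation_dist_def)
  qed
  have "((\<lambda>z. (L2_norm lborel (\<lambda>t. x (t + z) - x t))\<^sup>2) \<longlongrightarrow> 0) (at 0)"
  proof (rule tendsto_sandwich[OF always_eventually always_eventually tendsto_const])
    show "((\<lambda>z. 2 * translation_dist ?y z) \<longlongrightarrow> 0) (at 0)"
      using tendsto_mult_left[OF translation_dist_tendsto_0[OF y], of 2] by simp
  qed (simp_all add: bound)
  then have "((\<lambda>z. sqrt ((L2_norm lborel (\<lambda>t. x (t + z) - x t))\<^sup>2)) \<longlongrightarrow> sqrt 0) (at 0)"
    by (rule tendsto_real_sqrt)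
  then show ?thesis
    by (simp add: L2_norm_nonneg)
qed

section \<open>The Fourier transform and Plancherel's theorem\<close>

lemma borel_measurable_iexp [measurable]: "iexp \<in> borel_measurable borel"
  by (intro borel_measurable_continuous_onI continuous_intros)

lemma cnj_iexp: "cnj (iexp x) = iexp (- x)"
  by (simp add: exp_cnj)

lemma iexp_add: "iexp (x + y) = iexp x * iexp y"
  by (simp add: exp_add ring_distribs)

lemma norm_iexp_minus_1_le: "cmod (iexp x - 1) \<le> \<bar>x\<bar>"
  using iexp_approx1[of x 0] by simp

lemma integrable_mult_iexp:
  assumes f: "integrable M f" and [measurable]: "h \<in> borel_measurable M"
  shows "integrable M (\<lambda>x. f x * iexp (h x))"
proof (rule Bochner_Integration.integrable_bound[OF f])
  note [measurable] = f
  show "(\<lambda>x. f x * iexp (h x)) \<in> borel_measurable M" by measurable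
qed (simp add: norm_mult)

lemma L2_mult_iexp:
  assumes "x \<in> L2 M" and [measurable]: "h \<in> borel_measurable M"
  shows "(\<lambda>p. x p * iexp (h p)) \<in> L2 M"
proof -
  note [measurable] = assms(1)
  have "(\<lambda>p. x p * iexp (h p)) \<in> borel_measurable M"
    by measurable
  then show ?thesis
    using L2_integrable_power2[OF assms(1)] by (simp add: L2_def norm_mult)
qed

definition fourier :: "('a::euclidean_space \<Rightarrow> complex) \<Rightarrow> 'a \<Rightarrow> complex" where
  "fourier x \<omega> = (\<integral>t. x t * iexp (- (t \<bullet> \<omega>)) \<partial>lborel)"

definition correlation :: "('a::euclidean_space \<Rightarrow> complex) \<Rightarrow> ('a \<Rightarrow> complex) \<Rightarrow> 'a \<Rightarrow> complex" where
  "correlation x y z = L2_inner lborel (\<lambda>t. x (t + z)) y"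

lemma borel_measurable_fourier [measurable]:
  assumes [measurable]: "x \<in> borel_measurable borel"
  shows "fourier x \<in> borel_measurable borel"
  unfolding fourier_def by measurable

lemma integrable_correlation_kernel:
  fixes x y :: "'a::euclidean_space \<Rightarrow> complex"
  assumes x: "integrable lborel x" and y: "integrable lborel y"
  shows "integrable (lborel \<Otimes>\<^sub>M lborel) (\<lambda>(t, z). x (t + z) * cnj (y t))"
proof (rule lborel_pair.Fubini_integrable)
  have [measurable]: "x \<in> borel_measurable borel" "y \<in> borel_measurable borel"
    using x y by auto
  show "(\<lambda>(t, z). x (t + z) * cnj (y t)) \<in> borel_measurable (lborel \<Otimes>\<^sub>M lborel)"
    by measurable
  have "(\<integral>z. cmod (x (t + z)) \<partial>lborel) = (\<integral>z. cmod (x z) \<partial>lborel)" for t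
    using integral_shift[of "\<lambda>z. cmod (x z)" t] by (simp add: add.commute)
  then show "integrable lborel
      (\<lambda>t. \<integral>z. norm (case (t, z) of (t, z) \<Rightarrow> x (t + z) * cnj (y t)) \<partial>lborel)"
    using y by (simp add: norm_mult)
  have "integrable lborel (\<lambda>z. x (t + z))" for t
    using integrable_shift[OF x, of t] by (simp add: add.commute)
  then show "AE t in lborel. integrable lborel (\<lambda>z. case (t, z) of (t, z) \<Rightarrow> x (t + z) * cnj (y t))"
    by simp
qed

lemma integrable_correlation:
  assumes "integrable lborel x" "integrable lborel y"
  shows "integrable lborel (correlation x y)"
  using lborel_pair.integrable_snd[OF integrable_correlation_kernel[OF assms]]
  by (simp add: correlation_def[abs_def] L2_inner_def)

lemma fourier_shift:
  assumes [measurable]: "x \<in> borel_measurable borel"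
  shows "fourier (\<lambda>z. x (z + t)) \<omega> = iexp (t \<bullet> \<omega>) * fourier x \<omega>"
proof -
  have "x (z + t) * iexp (- (z \<bullet> \<omega>)) = iexp (t \<bullet> \<omega>) * (x (z + t) * iexp (- ((z + t) \<bullet> \<omega>)))" for z
  proof -
    have "iexp (- (z \<bullet> \<omega>)) = iexp (t \<bullet> \<omega>) * iexp (- ((z + t) \<bullet> \<omega>))"
      unfolding iexp_add[symmetric] by (simp add: inner_add_left)
    then show ?thesis
      by (simp only: mult_ac)
  qed
  then have "fourier (\<lambda>z. x (z + t)) \<omega>
      = iexp (t \<bullet> \<omega>) * (\<integral>z. x (z + t) * iexp (- ((z + t) \<bullet> \<omega>)) \<partial>lborel)"
    unfolding fourier_def by (simp only: integral_mult_right_zero)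
  also have "(\<integral>z. x (z + t) * iexp (- ((z + t) \<bullet> \<omega>)) \<partial>lborel) = fourier x \<omega>"
    unfolding fourier_def by (rule integral_shift) measurable
  finally show ?thesis .
qed

lemma fourier_correlation:
  fixes x y :: "'a::euclidean_space \<Rightarrow> complex"
  assumes x: "integrable lborel x" and y: "integrable lborel y"
  shows "fourier (correlation x y) \<omega> = fourier x \<omega> * cnj (fourier y \<omega>)"
proof -
  have [measurable]: "x \<in> borel_measurable borel"
    using x by auto
  let ?k = "\<lambda>t z. x (t + z) * cnj (y t) * iexp (- (z \<bullet> \<omega>))"
  have "integrable (lborel \<Otimes>\<^sub>M lborel)
      (\<lambda>p. (case p of (t, z) \<Rightarrow> x (t + z) * cnj (y t)) * iexp (- (snd p \<bullet> \<omega>)))"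
    by (intro integrable_mult_iexp[where h = "\<lambda>p. - (snd p \<bullet> \<omega>)"] integrable_correlation_kernel x y)
       measurable
  then have kernel: "integrable (lborel \<Otimes>\<^sub>M lborel) (\<lambda>(t, z). ?k t z)"
    by (simp add: case_prod_unfold)
  have slice: "(\<integral>z. ?k t z \<partial>lborel) = cnj (y t * iexp (- (t \<bullet> \<omega>))) * fourier x \<omega>" for t
  proof -
    have "(\<integral>z. ?k t z \<partial>lborel) = (\<integral>z. cnj (y t) * (x (z + t) * iexp (- (z \<bullet> \<omega>))) \<partial>lborel)"
      by (simp only: add.commute mult_ac)
    also have "\<dots> = cnj (y t) * fourier (\<lambda>z. x (z + t)) \<omega>"
      unfolding fourier_def by (rule integral_mult_right_zero)
    also have "\<dots> = cnj (y t) * (iexp (t \<bullet> \<omega>) * fourier x \<omega>)"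
      by (subst fourier_shift) measurable
    finally show ?thesis
      by (simp only: complex_cnj_mult cnj_iexp minus_minus mult.assoc)
  qed
  have "fourier (correlation x y) \<omega> = (\<integral>z. (\<integral>t. ?k t z \<partial>lborel) \<partial>lborel)"
    by (simp add: fourier_def correlation_def L2_inner_def)
  also have "\<dots> = (\<integral>t. (\<integral>z. ?k t z \<partial>lborel) \<partial>lborel)"
    by (rule lborel_pair.Fubini_integral[OF kernel])
  also have "\<dots> = (\<integral>t. cnj (y t * iexp (- (t \<bullet> \<omega>))) \<partial>lborel) * fourier x \<omega>"
    unfolding slice by (rule integral_mult_left_zero)
  also have "(\<integral>t. cnj (y t * iexp (- (t \<bullet> \<omega>))) \<partial>lborel) = cnj (fourier y \<omega>)"
    unfolding fourier_def by (rule Bochner_Integration.integral_cnj)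
  finally show ?thesis by (simp add: mult.commute)
qed

lemma
  fixes x y :: "'a::euclidean_space \<Rightarrow> complex"
  assumes x: "integrable lborel x" and y: "integrable lborel y"
  shows integrable_fourier_mult: "integrable lborel (\<lambda>\<omega>. fourier x \<omega> * y \<omega>)"
    and fourier_multiplication_formula:
      "(\<integral>\<omega>. fourier x \<omega> * y \<omega> \<partial>lborel) = (\<integral>t. x t * fourier y t \<partial>lborel)"
proof -
  have [measurable]: "x \<in> borel_measurable borel" "y \<in> borel_measurable borel"
    using x y by auto
  let ?k = "\<lambda>t \<omega>. x t * (y \<omega> * iexp (- (\<omega> \<bullet> t)))"
  have kernel: "integrable (lborel \<Otimes>\<^sub>M lborel) (\<lambda>(t, \<omega>). ?k t \<omega>)"
  proof (rule lborel_pair.Fubini_integrable)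
    show "integrable lborel (\<lambda>t. \<integral>\<omega>. norm (case (t, \<omega>) of (t, \<omega>) \<Rightarrow> ?k t \<omega>) \<partial>lborel)"
      using x by (simp add: norm_mult)
    show "AE t in lborel. integrable lborel (\<lambda>\<omega>. case (t, \<omega>) of (t, \<omega>) \<Rightarrow> ?k t \<omega>)"
      unfolding prod.case
      by (intro AE_I2 integrable_mult_right integrable_mult_iexp[where h = "\<lambda>\<omega>. - (\<omega> \<bullet> _)"] y)
        measurable
  qed measurable
  have slice: "(\<integral>t. ?k t \<omega> \<partial>lborel) = fourier x \<omega> * y \<omega>" for \<omega>
  proof -
    have "(\<integral>t. ?k t \<omega> \<partial>lborel) = (\<integral>t. (x t * iexp (- (t \<bullet> \<omega>))) * y \<omega> \<partial>lborel)"
      by (simp only: inner_commute mult_ac)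
    then show ?thesis
      unfolding fourier_def by (simp only: integral_mult_left_zero)
  qed
  show "integrable lborel (\<lambda>\<omega>. fourier x \<omega> * y \<omega>)"
    using lborel_pair.integrable_snd[OF kernel] unfolding slice .
  have "(\<integral>\<omega>. fourier x \<omega> * y \<omega> \<partial>lborel) = (\<integral>t. (\<integral>\<omega>. ?k t \<omega> \<partial>lborel) \<partial>lborel)"
    unfolding slice[symmetric] by (rule lborel_pair.Fubini_integral[OF kernel])
  then show "(\<integral>\<omega>. fourier x \<omega> * y \<omega> \<partial>lborel) = (\<integral>t. x t * fourier y t \<partial>lborel)"
    by (simp only: fourier_def integral_mult_right_zero)
qed

lemma fourier_gaussian:
  assumes s: "0 < s"
  shows "fourier (\<lambda>w. complex_of_real (std_normal_density (s * w))) z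
       = complex_of_real (sqrt (2 * pi) / s * std_normal_density (z / s))"
proof -
  have "complex_of_real (exp (- (- z / s)\<^sup>2 / 2)) = char std_normal_distribution (- z / s)"
    by (simp add: char_std_normal_distribution)
  also have "\<dots> = (\<integral>x. std_normal_density x *\<^sub>R iexp (- z / s * x) \<partial>lborel)"
    unfolding char_def by (subst integral_density) auto
  also have "\<dots> = \<bar>s\<bar> *\<^sub>R (\<integral>w. std_normal_density (0 + s * w) *\<^sub>R iexp (- z / s * (0 + s * w)) \<partial>lborel)"
    using s by (intro lborel_integral_real_affine) auto
  also have "\<dots> = s *\<^sub>R fourier (\<lambda>w. complex_of_real (std_normal_density (s * w))) z"
    using s by (simp add: fourier_def scaleR_conv_of_real mult.commute)
  finally have "fourier (\<lambda>w. complex_of_real (std_normal_density (s * w))) z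
      = complex_of_real (exp (- (- z / s)\<^sup>2 / 2)) / s"
    using s by (simp add: scaleR_conv_of_real field_simps)
  then show ?thesis by (simp add: std_normal_density_def)
qed

lemma norm_correlation_le:
  assumes "x \<in> L2 lborel" "y \<in> L2 lborel"
  shows "cmod (correlation x y z) \<le> L2_norm lborel x * L2_norm lborel y"
  using L2_Cauchy_Schwarz[OF L2_shift[OF assms(1)] assms(2), of z] assms(1)
  by (simp add: correlation_def L2_norm_shift)

lemma isCont_correlation_0:
  assumes x: "x \<in> L2 lborel" and y: "y \<in> L2 lborel"
  shows "isCont (correlation x y) 0"
  unfolding isCont_def
proof (rule Lim_transform[OF tendsto_const], rule Lim_null_comparison[OF always_eventually],
    intro allI)
  fix z
  have "correlation x y z - correlation x y 0 = L2_inner lborel (\<lambda>t. x (t + z) - x t) y"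
    using L2_inner_diff_left[OF L2_shift[OF x] x y, of z] by (simp add: correlation_def)
  then show "norm (correlation x y z - correlation x y 0)
      \<le> L2_norm lborel (\<lambda>t. x (t + z) - x t) * L2_norm lborel y"
    using L2_Cauchy_Schwarz[OF L2_diff[OF L2_shift[OF x] x] y] by simp
next
  show "((\<lambda>z. L2_norm lborel (\<lambda>t. x (t + z) - x t) * L2_norm lborel y) \<longlongrightarrow> 0) (at 0)"
    by (intro tendsto_mult_left_zero L2_norm_translation_tendsto_0 x)
qed

lemma
  assumes k: "integrable lborel k" and s: "0 < s"
  shows integrable_gaussian_fourier_power2:
      "integrable lborel (\<lambda>w. (cmod (fourier k w))\<^sup>2 * std_normal_density (s * w))"
    and integral_gaussian_fourier_power2:
      "complex_of_real (\<integral>w. (cmod (fourier k w))\<^sup>2 * std_normal_density (s * w) \<partial>lborel)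
        = sqrt (2 * pi) * (\<integral>z. correlation k k (s * z) * std_normal_density z \<partial>lborel)"
proof -
  let ?g = "\<lambda>w. complex_of_real (std_normal_density (s * w))"
  have "integrable lborel (\<lambda>w. std_normal_density (0 + s * w))"
    using s by (intro lborel_integrable_real_affine) auto
  then have gaussian: "integrable lborel ?g"
    by simp
  have power2: "fourier (correlation k k) w * ?g w
      = complex_of_real ((cmod (fourier k w))\<^sup>2 * std_normal_density (s * w))" for w
    unfolding fourier_correlation[OF k k] complex_norm_square[symmetric] by simp
  note corr = integrable_correlation[OF k k]
  show "integrable lborel (\<lambda>w. (cmod (fourier k w))\<^sup>2 * std_normal_density (s * w))"
    using integrable_fourier_mult[OF corr gaussian]
    by (simp only: power2 complex_of_real_integrable_eq)
  have "complex_of_real (\<integral>w. (cmod (fourier k w))\<^sup>2 * std_normal_density (s * w) \<partial>lborel)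
      = (\<integral>z. correlation k k z *
          complex_of_real (sqrt (2 * pi) / s * std_normal_density (z / s)) \<partial>lborel)"
    using fourier_multiplication_formula[OF corr gaussian]
    by (simp only: power2 integral_complex_of_real fourier_gaussian[OF s])
  also have "\<dots> = \<bar>s\<bar> *\<^sub>R (\<integral>z. correlation k k (0 + s * z) *
      complex_of_real (sqrt (2 * pi) / s * std_normal_density ((0 + s * z) / s)) \<partial>lborel)"
    using s by (intro lborel_integral_real_affine) auto
  also have "\<dots> = \<bar>s\<bar> *\<^sub>R (\<integral>z. complex_of_real (sqrt (2 * pi) / s) *
      (correlation k k (s * z) * complex_of_real (std_normal_density z)) \<partial>lborel)"
    using s by (simp add: mult_ac)
  also have "\<dots> = sqrt (2 * pi) * (\<integral>z. correlation k k (s * z) * std_normal_density z \<partial>lborel)"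
    using s by (simp only: integral_mult_right_zero) (simp add: scaleR_conv_of_real)
  finally show "complex_of_real (\<integral>w. (cmod (fourier k w))\<^sup>2 * std_normal_density (s * w) \<partial>lborel)
      = sqrt (2 * pi) * (\<integral>z. correlation k k (s * z) * std_normal_density z \<partial>lborel)" .
qed

lemma nn_integral_gaussian_LIMSEQ:
  assumes [measurable]: "f \<in> borel_measurable borel"
    and s: "decseq s" "\<And>n. 0 \<le> s n" "s \<longlonglongrightarrow> 0"
  shows "(\<lambda>n. \<integral>\<^sup>+w. f w * ennreal (std_normal_density (s n * w)) \<partial>lborel)
    \<longlonglongrightarrow> (\<integral>\<^sup>+w. f w * ennreal (std_normal_density 0) \<partial>lborel)"
proof (rule nn_integral_LIMSEQ)
  show "incseq (\<lambda>n w. f w * ennreal (std_normal_density (s n * w)))"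
  proof (intro incseq_SucI le_funI mult_left_mono ennreal_leI)
    fix n w
    have "(s (Suc n) * w)\<^sup>2 \<le> (s n * w)\<^sup>2"
      using decseq_SucD[OF s(1), of n] s(2)[of "Suc n"]
      by (simp add: power_mult_distrib power_mono mult_right_mono)
    then show "std_normal_density (s n * w) \<le> std_normal_density (s (Suc n) * w)"
      by (simp add: std_normal_density_def divide_right_mono)
  qed simp
  fix w
  have "(\<lambda>n. std_normal_density (s n * w)) \<longlonglongrightarrow> std_normal_density (0 * w)"
    unfolding std_normal_density_def by (intro tendsto_intros s) auto
  then show "(\<lambda>n. f w * ennreal (std_normal_density (s n * w)))
      \<longlonglongrightarrow> f w * ennreal (std_normal_density 0)"
    by (intro tendsto_mult_ennreal tendsto_const tendsto_ennrealI)
       (simp_all add: std_normal_density_def)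
qed measurable

lemma integral_gaussian_LIMSEQ:
  fixes f :: "real \<Rightarrow> complex"
  assumes [measurable]: "f \<in> borel_measurable borel" and "isCont f 0"
    and bound: "\<And>z. cmod (f z) \<le> B" and s: "s \<longlonglongrightarrow> 0"
  shows "(\<lambda>n. \<integral>z. f (s n * z) * std_normal_density z \<partial>lborel) \<longlonglongrightarrow> f 0"
proof -
  have "(\<lambda>n. \<integral>z. f (s n * z) * std_normal_density z \<partial>lborel)
      \<longlonglongrightarrow> (\<integral>z. f 0 * std_normal_density z \<partial>lborel)"
  proof (rule integral_dominated_convergence[where w = "\<lambda>z. B * std_normal_density z"])
    show "AE z in lborel. (\<lambda>n. f (s n * z) * std_normal_density z) \<longlonglongrightarrow> f 0 * std_normal_density z"
      by (intro AE_I2 tendsto_mult_right isCont_tendsto_compose[OF \<open>isCont f 0\<close>]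
          tendsto_mult_left_zero s)
    show "AE z in lborel. norm (f (s n * z) * std_normal_density z) \<le> B * std_normal_density z" for n
      by (intro AE_I2) (simp add: norm_mult mult_right_mono bound)
  qed auto
  also have "(\<integral>z. f 0 * std_normal_density z \<partial>lborel) = f 0"
    by (simp only: integral_mult_right_zero integral_complex_of_real) simp
  finally show ?thesis .
qed

lemma integral_gaussian_fourier_power2_LIMSEQ:
  fixes k :: "real \<Rightarrow> complex"
  assumes k: "integrable lborel k" "k \<in> L2 lborel" and s: "\<And>n. 0 < s n" "s \<longlonglongrightarrow> 0"
  shows "(\<lambda>n. \<integral>w. (cmod (fourier k w))\<^sup>2 * std_normal_density (s n * w) \<partial>lborel)
    \<longlonglongrightarrow> sqrt (2 * pi) * (L2_norm lborel k)\<^sup>2"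
proof -
  have [measurable]: "correlation k k \<in> borel_measurable borel"
    using integrable_correlation[OF k(1,1)] by auto
  have "(\<lambda>n. complex_of_real (\<integral>w. (cmod (fourier k w))\<^sup>2 * std_normal_density (s n * w) \<partial>lborel))
      \<longlonglongrightarrow> complex_of_real (sqrt (2 * pi)) * correlation k k 0"
    unfolding integral_gaussian_fourier_power2[OF k(1) s(1)]
    by (intro tendsto_mult_left integral_gaussian_LIMSEQ[OF _ _ norm_correlation_le]
        isCont_correlation_0 k s) measurable
  moreover have "correlation k k 0 = complex_of_real ((L2_norm lborel k)\<^sup>2)"
    by (simp add: correlation_def L2_inner_self)
  ultimately show ?thesis
    by (simp only: of_real_mult[symmetric] tendsto_of_real_iff)
qed

theorem Plancherel:
  fixes k :: "real \<Rightarrow> complex"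
  assumes k: "integrable lborel k" "k \<in> L2 lborel"
  shows "(\<integral>\<^sup>+w. ennreal ((cmod (fourier k w))\<^sup>2) \<partial>lborel)
       = ennreal (2 * pi) * (\<integral>\<^sup>+x. ennreal ((cmod (k x))\<^sup>2) \<partial>lborel)"
proof -
  have [measurable]: "k \<in> borel_measurable borel"
    using k(1) by auto
  define s where "s n = inverse (real (Suc n))" for n
  have s: "0 < s n" "decseq s" "s \<longlonglongrightarrow> 0" for n
    unfolding s_def using LIMSEQ_inverse_real_of_nat
    by (auto simp: decseq_def intro: le_imp_inverse_le)
  let ?E = "\<lambda>w. ennreal ((cmod (fourier k w))\<^sup>2)"
  have "(\<lambda>n. ennreal (\<integral>w. (cmod (fourier k w))\<^sup>2 * std_normal_density (s n * w) \<partial>lborel))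
      \<longlonglongrightarrow> ennreal (sqrt (2 * pi) * (L2_norm lborel k)\<^sup>2)"
    by (intro tendsto_ennrealI integral_gaussian_fourier_power2_LIMSEQ k s)
  moreover have "ennreal (\<integral>w. (cmod (fourier k w))\<^sup>2 * std_normal_density (s n * w) \<partial>lborel)
      = (\<integral>\<^sup>+w. ?E w * ennreal (std_normal_density (s n * w)) \<partial>lborel)" for n
    using nn_integral_eq_integral[OF integrable_gaussian_fourier_power2[OF k(1) s(1)]]
    by (simp add: ennreal_mult)
  ultimately have "(\<lambda>n. \<integral>\<^sup>+w. ?E w * ennreal (std_normal_density (s n * w)) \<partial>lborel)
      \<longlonglongrightarrow> ennreal (sqrt (2 * pi) * (L2_norm lborel k)\<^sup>2)"
    by simp
  then have "(\<integral>\<^sup>+w. ?E w * ennreal (std_normal_density 0) \<partial>lborel)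
      = ennreal (sqrt (2 * pi) * (L2_norm lborel k)\<^sup>2)"
    using s by (intro LIMSEQ_unique[OF nn_integral_gaussian_LIMSEQ]) (auto intro: less_imp_le)
  then have "ennreal (sqrt (2 * pi)) * (ennreal (1 / sqrt (2 * pi)) * (\<integral>\<^sup>+w. ?E w \<partial>lborel))
      = ennreal (sqrt (2 * pi)) * ennreal (sqrt (2 * pi) * (L2_norm lborel k)\<^sup>2)"
    by (simp add: nn_integral_multc std_normal_density_def mult.commute)
  then show ?thesis
    by (simp add: nn_integral_eq_L2_norm[OF k(2)] mult.assoc[symmetric] flip: ennreal_mult)
qed

section \<open>Phase-space displacements and the uncertainty principle\<close>

text \<open>
  Weyl's symmetric phase \<open>v \<bullet> w / 2\<close> makes \<open>s \<mapsto> weyl (s v) (s w) (s \<theta>)\<close> the one-parameter unitary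
  group generated by the self-adjoint operator \<open>v \<bullet> p - i w \<bullet> \<nabla> + \<theta>\<close>.
\<close>

definition weyl :: "'a::euclidean_space \<Rightarrow> 'a \<Rightarrow> real \<Rightarrow> ('a \<Rightarrow> complex) \<Rightarrow> 'a \<Rightarrow> complex" where
  "weyl v w \<theta> x p = iexp (p \<bullet> v + v \<bullet> w / 2 + \<theta>) * x (p + w)"

lemma borel_measurable_weyl [measurable]:
  assumes [measurable]: "x \<in> borel_measurable borel"
  shows "weyl v w \<theta> x \<in> borel_measurable borel"
  unfolding weyl_def[abs_def] by measurable

lemma integrable_weyl:
  assumes "integrable lborel x"
  shows "integrable lborel (weyl v w \<theta> x)"
  using integrable_mult_iexp[OF integrable_shift[OF assms, of w], of "\<lambda>p. p \<bullet> v + v \<bullet> w / 2 + \<theta>"]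
  by (simp add: weyl_def[abs_def] mult.commute)

lemma L2_weyl:
  assumes "x \<in> L2 lborel"
  shows "weyl v w \<theta> x \<in> L2 lborel"
  using L2_mult_iexp[OF L2_shift[OF assms, of w], of "\<lambda>p. p \<bullet> v + v \<bullet> w / 2 + \<theta>"]
  by (simp add: weyl_def[abs_def] mult.commute)

lemma L2_norm_weyl:
  assumes "x \<in> L2 lborel"
  shows "L2_norm lborel (weyl v w \<theta> x) = L2_norm lborel x"
  using L2_norm_shift[OF assms, of w] by (simp add: L2_norm_def weyl_def norm_mult)

lemma L2_inner_weyl_left:
  assumes [measurable]: "x \<in> borel_measurable borel" "y \<in> borel_measurable borel"
  shows "L2_inner lborel (weyl v w \<theta> x) y = L2_inner lborel x (weyl (- v) (- w) (- \<theta>) y)"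
proof -
  have "weyl v w \<theta> x p * cnj (y p) = x (p + w) * cnj (weyl (- v) (- w) (- \<theta>) y (p + w))" for p
  proof -
    have "- ((p + w) \<bullet> (- v) + (- v) \<bullet> (- w) / 2 + (- \<theta>)) = p \<bullet> v + v \<bullet> w / 2 + \<theta>"
      by (simp add: inner_add_left inner_commute[of w v])
    then show ?thesis
      by (simp only: weyl_def complex_cnj_mult cnj_iexp) (simp add: mult_ac)
  qed
  then have "L2_inner lborel (weyl v w \<theta> x) y
      = (\<integral>p. x (p + w) * cnj (weyl (- v) (- w) (- \<theta>) y (p + w)) \<partial>lborel)"
    by (simp add: L2_inner_def)
  also have "\<dots> = L2_inner lborel x (weyl (- v) (- w) (- \<theta>) y)"
    unfolding L2_inner_def by (rule integral_shift) measurable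
  finally show ?thesis .
qed

lemma weyl_commute:
  "weyl v w \<theta> (weyl v' w' \<theta>' x) p = iexp (w \<bullet> v' - v \<bullet> w') * weyl v' w' \<theta>' (weyl v w \<theta> x) p"
proof -
  have "iexp (p \<bullet> v + v \<bullet> w / 2 + \<theta>) * iexp ((p + w) \<bullet> v' + v' \<bullet> w' / 2 + \<theta>')
      = iexp (w \<bullet> v' - v \<bullet> w') *
        (iexp (p \<bullet> v' + v' \<bullet> w' / 2 + \<theta>') * iexp ((p + w') \<bullet> v + v \<bullet> w / 2 + \<theta>))"
    unfolding iexp_add[symmetric] by (simp add: inner_add_left inner_commute algebra_simps)
  then show ?thesis
    unfolding weyl_def add.assoc[of p] add.commute[of w' w] by (simp only: mult.assoc[symmetric])
qed

lemma L2_inner_weyl_commute: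
  assumes "x \<in> L2 lborel"
  shows "L2_inner lborel (weyl v' w' \<theta>' x) (weyl (- v) (- w) (- \<theta>) x)
    = iexp (w \<bullet> v' - v \<bullet> w') * L2_inner lborel (weyl v w \<theta> x) (weyl (- v') (- w') (- \<theta>') x)"
proof -
  note [measurable] = assms
  have "L2_inner lborel (weyl v' w' \<theta>' x) (weyl (- v) (- w) (- \<theta>) x)
      = L2_inner lborel (weyl v w \<theta> (weyl v' w' \<theta>' x)) x"
    by (rule L2_inner_weyl_left[symmetric]) measurable
  also have "\<dots> = iexp (w \<bullet> v' - v \<bullet> w') * L2_inner lborel (weyl v' w' \<theta>' (weyl v w \<theta> x)) x"
    unfolding L2_inner_def weyl_commute[of v w] by (simp only: mult.assoc integral_mult_right_zero)
  also have "L2_inner lborel (weyl v' w' \<theta>' (weyl v w \<theta> x)) x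
      = L2_inner lborel (weyl v w \<theta> x) (weyl (- v') (- w') (- \<theta>') x)"
    by (rule L2_inner_weyl_left) measurable
  finally show ?thesis .
qed

lemma weyl_commutator_identity:
  fixes x :: "'a::euclidean_space \<Rightarrow> complex" and v w v' w' :: 'a and \<theta> \<theta>' :: real
  assumes x: "x \<in> L2 lborel"
  defines "u \<equiv> weyl v w \<theta> x" and "u' \<equiv> weyl (- v) (- w) (- \<theta>) x"
    and "y \<equiv> weyl v' w' \<theta>' x" and "y' \<equiv> weyl (- v') (- w') (- \<theta>') x"
  shows "(iexp (w \<bullet> v' - v \<bullet> w') - 1) * L2_inner lborel u y'
    = L2_inner lborel (\<lambda>p. y p - x p) (\<lambda>p. u' p - x p)
      - L2_inner lborel (\<lambda>p. u p - x p) (\<lambda>p. y' p - x p)"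
proof -
  note [measurable] = x
  have mem: "u \<in> L2 lborel" "u' \<in> L2 lborel" "y \<in> L2 lborel" "y' \<in> L2 lborel"
    unfolding u_def u'_def y_def y'_def by (intro L2_weyl x)+
  have "L2_inner lborel y u' = iexp (w \<bullet> v' - v \<bullet> w') * L2_inner lborel u y'"
    unfolding u_def u'_def y_def y'_def by (rule L2_inner_weyl_commute[OF x])
  moreover have "L2_inner lborel u x = L2_inner lborel x u'"
    "L2_inner lborel y x = L2_inner lborel x y'"
    unfolding u_def u'_def y_def y'_def by (rule L2_inner_weyl_left; measurable)+
  ultimately show ?thesis
    using mem x by (simp add: L2_inner_diff_left L2_inner_diff_right L2_diff left_diff_distrib)
qed

lemma weyl_commutator_bound:
  fixes x :: "'a::euclidean_space \<Rightarrow> complex"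
  assumes x: "x \<in> L2 lborel"
    and displ: "L2_norm lborel (\<lambda>p. weyl v w \<theta> x p - x p) \<le> \<delta>"
      "L2_norm lborel (\<lambda>p. weyl (- v) (- w) (- \<theta>) x p - x p) \<le> \<delta>"
    and displ': "L2_norm lborel (\<lambda>p. weyl v' w' \<theta>' x p - x p) \<le> \<epsilon>"
      "L2_norm lborel (\<lambda>p. weyl (- v') (- w') (- \<theta>') x p - x p) \<le> \<epsilon>"
  shows "cmod (iexp (w \<bullet> v' - v \<bullet> w') - 1) * ((L2_norm lborel x)\<^sup>2 - (\<delta> + \<epsilon>) * L2_norm lborel x)
    \<le> 2 * \<delta> * \<epsilon>"
proof -
  let ?u = "weyl v w \<theta> x" and ?u' = "weyl (- v) (- w) (- \<theta>) x"
  let ?y = "weyl v' w' \<theta>' x" and ?y' = "weyl (- v') (- w') (- \<theta>') x"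
  let ?N = "L2_norm lborel x" and ?P = "L2_inner lborel ?u ?y'"
  have diffs: "(\<lambda>p. weyl a b \<phi> x p - x p) \<in> L2 lborel" for a b \<phi>
    by (intro L2_diff L2_weyl x)
  have "?N\<^sup>2 - (\<delta> + \<epsilon>) * ?N \<le> cmod ?P"
    by (intro L2_inner_perturbation_ge L2_weyl L2_norm_weyl x displ displ')
  then have "cmod (iexp (w \<bullet> v' - v \<bullet> w') - 1) * (?N\<^sup>2 - (\<delta> + \<epsilon>) * ?N)
      \<le> cmod ((iexp (w \<bullet> v' - v \<bullet> w') - 1) * ?P)"
    unfolding norm_mult by (rule mult_left_mono) simp
  also have "\<dots> \<le> cmod (L2_inner lborel (\<lambda>p. ?y p - x p) (\<lambda>p. ?u' p - x p))
      + cmod (L2_inner lborel (\<lambda>p. ?u p - x p) (\<lambda>p. ?y' p - x p))"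
    unfolding weyl_commutator_identity[OF x] by (rule norm_triangle_ineq4)
  also have "\<dots> \<le> \<epsilon> * \<delta> + \<delta> * \<epsilon>"
    by (intro add_mono L2_inner_le diffs displ displ')
  finally show ?thesis by simp
qed

lemma norm_iexp_minus_1_over_square_tendsto:
  "((\<lambda>s. cmod (iexp (s\<^sup>2 * D) - 1) / s\<^sup>2) \<longlongrightarrow> \<bar>D\<bar>) (at_right 0)"
proof (cases "D = 0")
  case False
  have "filterlim (\<lambda>s. \<i> * complex_of_real (s\<^sup>2 * D)) (at 0) (at_right 0)"
    using False by (auto simp: filterlim_at eventually_at_filter intro!: tendsto_eq_intros)
  then have "((\<lambda>s. cmod ((iexp (s\<^sup>2 * D) - 1) / (\<i> * complex_of_real (s\<^sup>2 * D))) * \<bar>D\<bar>)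
      \<longlongrightarrow> cmod 1 * \<bar>D\<bar>) (at_right 0)"
    by (intro tendsto_intros filterlim_compose[OF lim_exp_minus_1])
  then show ?thesis
    using False by (simp add: norm_divide norm_mult norm_power abs_mult)
qed simp

theorem weyl_uncertainty:
  fixes x :: "'a::euclidean_space \<Rightarrow> complex"
  assumes x: "x \<in> L2 lborel"
    and displ: "\<And>s. L2_norm lborel (\<lambda>p. weyl (s *\<^sub>R v) (s *\<^sub>R w) (s * \<theta>) x p - x p) \<le> \<bar>s\<bar> * \<alpha>"
    and displ': "\<And>s. L2_norm lborel (\<lambda>p. weyl (s *\<^sub>R v') (s *\<^sub>R w') (s * \<theta>') x p - x p) \<le> \<bar>s\<bar> * \<beta>"
  shows "\<bar>v \<bullet> w' - w \<bullet> v'\<bar> * (L2_norm lborel x)\<^sup>2 \<le> 2 * \<alpha> * \<beta>"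
proof -
  let ?N = "L2_norm lborel x"
  define D where "D = w \<bullet> v' - v \<bullet> w'"
  define r where "r s = cmod (iexp (s\<^sup>2 * D) - 1) / s\<^sup>2" for s
  have bound: "r s * (?N\<^sup>2 - s * (\<alpha> + \<beta>) * ?N) \<le> 2 * \<alpha> * \<beta>" if s: "0 < s" for s
  proof -
    have "cmod (iexp (s\<^sup>2 * D) - 1) * (?N\<^sup>2 - (s * \<alpha> + s * \<beta>) * ?N) \<le> 2 * (s * \<alpha>) * (s * \<beta>)"
    proof -
      have "s\<^sup>2 * D = (s *\<^sub>R w) \<bullet> (s *\<^sub>R v') - (s *\<^sub>R v) \<bullet> (s *\<^sub>R w')"
        by (simp add: D_def power2_eq_square right_diff_distrib)
      then show ?thesis
        using displ[of s] displ[of "- s"] displ'[of s] displ'[of "- s"] s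
        by (simp only:)
           (intro weyl_commutator_bound[OF x, where \<theta> = "s * \<theta>" and \<theta>' = "s * \<theta>'"]; simp)
    qed
    then have "s\<^sup>2 * (r s * (?N\<^sup>2 - s * (\<alpha> + \<beta>) * ?N)) \<le> s\<^sup>2 * (2 * \<alpha> * \<beta>)"
      using s by (simp add: r_def power2_eq_square distrib_left mult_ac)
    then show ?thesis
      using s by simp
  qed
  have "((\<lambda>s. r s * (?N\<^sup>2 - s * (\<alpha> + \<beta>) * ?N)) \<longlongrightarrow> \<bar>D\<bar> * (?N\<^sup>2 - 0 * (\<alpha> + \<beta>) * ?N)) (at_right 0)"
    unfolding r_def by (intro tendsto_intros norm_iexp_minus_1_over_square_tendsto)
  moreover have "eventually (\<lambda>s. r s * (?N\<^sup>2 - s * (\<alpha> + \<beta>) * ?N) \<le> 2 * \<alpha> * \<beta>) (at_right 0)"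
    using bound by (auto simp: eventually_at_filter intro!: always_eventually)
  ultimately have "\<bar>D\<bar> * (?N\<^sup>2 - 0 * (\<alpha> + \<beta>) * ?N) \<le> 2 * \<alpha> * \<beta>"
    by (rule tendsto_upperbound) simp
  then show ?thesis
    by (simp add: D_def abs_minus_commute)
qed

section \<open>Linear canonical transforms\<close>

definition lct_integral :: "lct_param \<Rightarrow> (real \<Rightarrow> complex) \<Rightarrow> real \<Rightarrow> complex" where
  "lct_integral M h u = (\<integral>t. h t * lct_kernel M t u \<partial>lborel)"

lemma integrable_mult_lct_kernel:
  assumes "integrable lborel h"
  shows "integrable lborel (\<lambda>t. h t * lct_kernel (a,b,c,d) t u)"
proof -
  have "integrable lborel (\<lambda>t. h t * iexp (a/(2*b) * t\<^sup>2 - t*u/b + d/(2*b) * u\<^sup>2))"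
    by (intro integrable_mult_iexp[where h = "\<lambda>t. a/(2*b) * t\<^sup>2 - t*u/b + d/(2*b) * u\<^sup>2"] assms)
       measurable
  then show ?thesis
    unfolding lct_kernel_def prod.case mult.left_commute[of _ "1 / _"]
    by (rule integrable_mult_right)
qed

lemma lct_integral_diff:
  assumes "integrable lborel h" "integrable lborel k"
  shows "lct_integral (a,b,c,d) (\<lambda>t. h t - k t) u
    = lct_integral (a,b,c,d) h u - lct_integral (a,b,c,d) k u"
  using assms[THEN integrable_mult_lct_kernel]
  by (simp add: lct_integral_def left_diff_distrib Bochner_Integration.integral_diff)

lemma power2_norm_lct_integral:
  "(cmod (lct_integral (a,b,c,d) h u))\<^sup>2
    = 1 / (2 * pi * \<bar>b\<bar>) * (cmod (fourier (\<lambda>t. h t * iexp (a/(2*b) * t\<^sup>2)) (u / b)))\<^sup>2"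
proof -
  let ?C = "1 / csqrt (\<i> * 2 * complex_of_real pi * complex_of_real b) * iexp (d/(2*b) * u\<^sup>2)"
  have "h t * lct_kernel (a,b,c,d) t u
      = ?C * (h t * iexp (a/(2*b) * t\<^sup>2) * iexp (- (t * (u / b))))" for t
  proof -
    have "iexp (a/(2*b) * t\<^sup>2 - t*u/b + d/(2*b) * u\<^sup>2)
        = iexp (a/(2*b) * t\<^sup>2) * iexp (- (t * (u / b))) * iexp (d/(2*b) * u\<^sup>2)"
      unfolding iexp_add[symmetric] by (simp add: algebra_simps)
    then show ?thesis
      unfolding lct_kernel_def prod.case by (simp only: mult_ac)
  qed
  then have "lct_integral (a,b,c,d) h u = ?C * fourier (\<lambda>t. h t * iexp (a/(2*b) * t\<^sup>2)) (u / b)"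
    unfolding lct_integral_def fourier_def inner_real_def by (simp only: integral_mult_right_zero)
  moreover have "(cmod ?C)\<^sup>2 = 1 / (2 * pi * \<bar>b\<bar>)"
    by (simp add: norm_mult norm_divide power_divide)
  ultimately show ?thesis by (simp only: norm_mult power_mult_distrib)
qed

theorem lct_Plancherel:
  assumes b: "b \<noteq> 0" and h: "integrable lborel h" "h \<in> L2 lborel"
  shows "(\<integral>\<^sup>+u. ennreal ((cmod (lct_integral (a,b,c,d) h u))\<^sup>2) \<partial>lborel)
       = (\<integral>\<^sup>+t. ennreal ((cmod (h t))\<^sup>2) \<partial>lborel)"
proof -
  have [measurable]: "h \<in> borel_measurable borel"
    using h(1) by auto
  define k where "k t = h t * iexp (a/(2*b) * t\<^sup>2)" for t
  have k: "integrable lborel k" "k \<in> L2 lborel"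
    unfolding k_def by (intro integrable_mult_iexp L2_mult_iexp h; measurable)+
  have [measurable]: "k \<in> borel_measurable borel"
    using k(1) by auto
  have "(\<integral>\<^sup>+u. ennreal ((cmod (lct_integral (a,b,c,d) h u))\<^sup>2) \<partial>lborel)
      = (\<integral>\<^sup>+u. ennreal (1 / (2 * pi * \<bar>b\<bar>)) * ennreal ((cmod (fourier k (u / b)))\<^sup>2) \<partial>lborel)"
    unfolding power2_norm_lct_integral k_def[abs_def] by (simp flip: ennreal_mult)
  also have "\<dots> = ennreal (1 / (2 * pi * \<bar>b\<bar>)) * (\<integral>\<^sup>+u. ennreal ((cmod (fourier k (u / b)))\<^sup>2) \<partial>lborel)"
    by (rule nn_integral_cmult) measurable
  also have "(\<integral>\<^sup>+u. ennreal ((cmod (fourier k (u / b)))\<^sup>2) \<partial>lborel)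
      = \<bar>b\<bar> * (\<integral>\<^sup>+w. ennreal ((cmod (fourier k w))\<^sup>2) \<partial>lborel)"
    using b nn_integral_real_affine[of "\<lambda>u. ennreal ((cmod (fourier k (u / b)))\<^sup>2)" b 0] by simp
  also have "\<dots> = \<bar>b\<bar> * (ennreal (2 * pi) * (\<integral>\<^sup>+t. ennreal ((cmod (k t))\<^sup>2) \<partial>lborel))"
    by (simp only: Plancherel[OF k])
  also have "ennreal (1 / (2 * pi * \<bar>b\<bar>)) * \<dots> = (\<integral>\<^sup>+t. ennreal ((cmod (k t))\<^sup>2) \<partial>lborel)"
    using b by (simp add: mult.assoc[symmetric] flip: ennreal_mult)
  finally show ?thesis
    by (simp add: k_def norm_mult)
qed

lemma lct_integral_weyl:
  assumes b: "b \<noteq> 0" and [measurable]: "h \<in> borel_measurable borel"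
  shows "lct_integral (a,b,c,d) (weyl (s * a) (s * b) \<theta> h) u
    = iexp (s * u + \<theta>) * lct_integral (a,b,c,d) h u"
proof -
  let ?K = "lct_kernel (a,b,c,d)" and ?\<phi> = "\<lambda>t. t * (s * a) + s * a * (s * b) / 2 + \<theta>"
  have kernel: "iexp (?\<phi> t) * ?K t u = iexp (s * u + \<theta>) * ?K (t + s * b) u" for t
  proof -
    have "?\<phi> t + (a/(2*b) * t\<^sup>2 - t*u/b + d/(2*b) * u\<^sup>2)
        = s * u + \<theta> + (a/(2*b) * (t + s * b)\<^sup>2 - (t + s * b)*u/b + d/(2*b) * u\<^sup>2)"
      using b by (simp add: field_simps power2_eq_square)
    then have "iexp (?\<phi> t) * iexp (a/(2*b) * t\<^sup>2 - t*u/b + d/(2*b) * u\<^sup>2)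
        = iexp (s * u + \<theta>) * iexp (a/(2*b) * (t + s * b)\<^sup>2 - (t + s * b)*u/b + d/(2*b) * u\<^sup>2)"
      by (simp only: iexp_add[symmetric])
    then show ?thesis
      unfolding lct_kernel_def prod.case by (simp only: mult.left_commute[of _ "1 / _"])
  qed
  have "weyl (s * a) (s * b) \<theta> h t * ?K t u
      = iexp (s * u + \<theta>) * (h (t + s * b) * ?K (t + s * b) u)" for t
  proof -
    have "weyl (s * a) (s * b) \<theta> h t * ?K t u = h (t + s * b) * (iexp (?\<phi> t) * ?K t u)"
      unfolding weyl_def inner_real_def by (simp only: mult_ac)
    then show ?thesis
      unfolding kernel by (simp only: mult_ac)
  qed
  then have "lct_integral (a,b,c,d) (weyl (s * a) (s * b) \<theta> h) u
      = iexp (s * u + \<theta>) * (\<integral>t. h (t + s * b) * ?K (t + s * b) u \<partial>lborel)"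
    unfolding lct_integral_def by (simp only: integral_mult_right_zero)
  also have "(\<integral>t. h (t + s * b) * ?K (t + s * b) u \<partial>lborel) = lct_integral (a,b,c,d) h u"
    unfolding lct_integral_def lct_kernel_def prod.case by (rule integral_shift) measurable
  finally show ?thesis .
qed

section \<open>Partial linear canonical transforms\<close>

definition lct_snd :: "lct_param \<Rightarrow> ('a \<times> real \<Rightarrow> complex) \<Rightarrow> 'a \<times> real \<Rightarrow> complex" where
  "lct_snd M H p = lct_integral M (\<lambda>\<tau>. H (fst p, \<tau>)) (snd p)"

definition snd_moment :: "real \<Rightarrow> ('a::euclidean_space \<times> real \<Rightarrow> complex) \<Rightarrow> ennreal" where
  "snd_moment m F = (\<integral>\<^sup>+p. ennreal ((snd p - m)\<^sup>2 * (cmod (F p))\<^sup>2) \<partial>lborel)"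

lemma borel_measurable_snd_euclidean [measurable]:
  "(snd :: 'a::euclidean_space \<times> real \<Rightarrow> real) \<in> borel_measurable borel"
  by (intro borel_measurable_continuous_onI continuous_intros)

lemma nn_integral_lborel_fst:
  fixes F :: "'a::euclidean_space \<times> 'b::euclidean_space \<Rightarrow> ennreal"
  assumes "F \<in> borel_measurable borel"
  shows "(\<integral>\<^sup>+x. (\<integral>\<^sup>+y. F (x, y) \<partial>lborel) \<partial>lborel) = (\<integral>\<^sup>+p. F p \<partial>lborel)"
proof -
  have "F \<in> borel_measurable (lborel \<Otimes>\<^sub>M lborel)"
    using assms by (simp add: lborel_prod)
  from lborel.nn_integral_fst[OF this] show ?thesis
    by (simp only: lborel_prod)
qed

lemma AE_L2_slice:
  fixes H :: "'a::euclidean_space \<times> 'b::euclidean_space \<Rightarrow> complex"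
  assumes "H \<in> L2 lborel"
  shows "AE x in lborel. (\<lambda>y. H (x, y)) \<in> L2 lborel"
proof -
  have [measurable]: "H \<in> borel_measurable (lborel \<Otimes>\<^sub>M lborel)"
    using L2_measurable[OF assms] by (simp add: lborel_prod)
  have "integrable (lborel \<Otimes>\<^sub>M lborel) (\<lambda>p. (cmod (H p))\<^sup>2)"
    using L2_integrable_power2[OF assms] by (simp add: lborel_prod)
  from lborel_pair.AE_integrable_fst'[OF this] show ?thesis
    by eventually_elim (simp add: L2_def)
qed

lemma borel_measurable_lct_snd [measurable]:
  fixes H :: "'a::euclidean_space \<times> real \<Rightarrow> complex"
  assumes "H \<in> borel_measurable borel"
  shows "lct_snd M H \<in> borel_measurable borel"
proof -
  obtain a b c d where M: "M = (a,b,c,d)" by (cases M)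
  have [measurable]: "H \<in> borel_measurable (borel \<Otimes>\<^sub>M borel)"
    using assms by (simp add: borel_prod)
  have "lct_snd M H \<in> borel_measurable (borel \<Otimes>\<^sub>M borel)"
    unfolding lct_snd_def lct_integral_def M lct_kernel_def prod.case by measurable
  then show ?thesis
    by (simp add: borel_prod)
qed

lemma lct_snd_Plancherel:
  fixes H :: "'a::euclidean_space \<times> real \<Rightarrow> complex"
  assumes b: "b \<noteq> 0" and H: "H \<in> L2 lborel" "\<And>x. integrable lborel (\<lambda>\<tau>. H (x, \<tau>))"
  shows "(\<integral>\<^sup>+p. ennreal ((cmod (lct_snd (a,b,c,d) H p))\<^sup>2) \<partial>lborel) = ennreal ((L2_norm lborel H)\<^sup>2)"
proof -
  note [measurable] = H(1)
  have "(\<integral>\<^sup>+p. ennreal ((cmod (lct_snd (a,b,c,d) H p))\<^sup>2) \<partial>lborel)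
      = (\<integral>\<^sup>+x. (\<integral>\<^sup>+u. ennreal ((cmod (lct_integral (a,b,c,d) (\<lambda>\<tau>. H (x, \<tau>)) u))\<^sup>2) \<partial>lborel) \<partial>lborel)"
    by (subst nn_integral_lborel_fst[symmetric], measurable) (simp add: lct_snd_def)
  also have "\<dots> = (\<integral>\<^sup>+x. (\<integral>\<^sup>+\<tau>. ennreal ((cmod (H (x, \<tau>)))\<^sup>2) \<partial>lborel) \<partial>lborel)"
    using AE_L2_slice[OF H(1)]
    by (intro nn_integral_cong_AE, eventually_elim) (rule lct_Plancherel[OF b H(2)])
  also have "\<dots> = ennreal ((L2_norm lborel H)\<^sup>2)"
    by (subst nn_integral_lborel_fst) (simp_all add: nn_integral_eq_L2_norm[OF H(1)])
  finally show ?thesis .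
qed

lemma weyl_snd_slice:
  fixes H :: "'a::euclidean_space \<times> real \<Rightarrow> complex"
  shows "weyl (s *\<^sub>R (0, a)) (s *\<^sub>R (0, b)) \<theta> H (x, \<tau>) = weyl (s * a) (s * b) \<theta> (\<lambda>\<tau>. H (x, \<tau>)) \<tau>"
  by (simp add: weyl_def)

lemma lct_snd_weyl_diff:
  fixes H :: "'a::euclidean_space \<times> real \<Rightarrow> complex"
  assumes b: "b \<noteq> 0" and H: "\<And>x. integrable lborel (\<lambda>\<tau>. H (x, \<tau>))"
  shows "lct_snd (a,b,c,d) (\<lambda>p. weyl (s *\<^sub>R (0, a)) (s *\<^sub>R (0, b)) \<theta> H p - H p) p
    = (iexp (s * snd p + \<theta>) - 1) * lct_snd (a,b,c,d) H p"
proof -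
  have "(\<lambda>\<tau>. H (fst p, \<tau>)) \<in> borel_measurable borel"
    using H by auto
  then show ?thesis
    using lct_integral_diff[OF integrable_weyl[OF H] H] lct_integral_weyl[OF b]
    by (simp add: lct_snd_def weyl_snd_slice left_diff_distrib del: scaleR_Pair)
qed

lemma power2_L2_norm_weyl_diff_le:
  fixes H :: "'a::euclidean_space \<times> real \<Rightarrow> complex"
  assumes b: "b \<noteq> 0" and H: "H \<in> L2 lborel" "\<And>x. integrable lborel (\<lambda>\<tau>. H (x, \<tau>))"
  shows "ennreal ((L2_norm lborel (\<lambda>p. weyl (s *\<^sub>R (0, a)) (s *\<^sub>R (0, b)) (s * - m) H p - H p))\<^sup>2)
    \<le> ennreal (s\<^sup>2) * snd_moment m (lct_snd (a,b,c,d) H)"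
proof -
  note [measurable] = H(1)
  let ?D = "\<lambda>p. weyl (s *\<^sub>R (0, a)) (s *\<^sub>R (0, b)) (s * - m) H p - H p" and ?F = "lct_snd (a,b,c,d) H"
  have "?D \<in> L2 lborel"
    by (intro L2_diff L2_weyl H)
  moreover have "integrable lborel (\<lambda>\<tau>. ?D (x, \<tau>))" for x
    unfolding weyl_snd_slice by (intro Bochner_Integration.integrable_diff integrable_weyl H)
  ultimately have "ennreal ((L2_norm lborel ?D)\<^sup>2)
      = (\<integral>\<^sup>+p. ennreal ((cmod (lct_snd (a,b,c,d) ?D p))\<^sup>2) \<partial>lborel)"
    by (rule lct_snd_Plancherel[OF b, symmetric])
  also have "\<dots> \<le> (\<integral>\<^sup>+p. ennreal (s\<^sup>2) * ennreal ((snd p - m)\<^sup>2 * (cmod (?F p))\<^sup>2) \<partial>lborel)"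
  proof (rule nn_integral_mono)
    fix p
    have "(cmod (lct_snd (a,b,c,d) ?D p))\<^sup>2 \<le> (\<bar>s * snd p + s * - m\<bar> * cmod (?F p))\<^sup>2"
      unfolding lct_snd_weyl_diff[OF b H(2)] norm_mult
      by (intro power_mono mult_right_mono norm_iexp_minus_1_le) auto
    also have "\<dots> = s\<^sup>2 * ((snd p - m)\<^sup>2 * (cmod (?F p))\<^sup>2)"
      by (simp add: power_mult_distrib right_diff_distrib[symmetric])
    finally show "ennreal ((cmod (lct_snd (a,b,c,d) ?D p))\<^sup>2)
        \<le> ennreal (s\<^sup>2) * ennreal ((snd p - m)\<^sup>2 * (cmod (?F p))\<^sup>2)"
      by (simp add: ennreal_leI flip: ennreal_mult)
  qed
  also have "\<dots> = ennreal (s\<^sup>2) * snd_moment m ?F"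
    unfolding snd_moment_def by (rule nn_integral_cmult) measurable
  finally show ?thesis .
qed

lemma L2_norm_weyl_diff_le:
  fixes H :: "'a::euclidean_space \<times> real \<Rightarrow> complex"
  assumes "b \<noteq> 0" "H \<in> L2 lborel" "\<And>x. integrable lborel (\<lambda>\<tau>. H (x, \<tau>))"
    and X: "snd_moment m (lct_snd (a,b,c,d) H) = ennreal (X\<^sup>2)" "0 \<le> X"
  shows "L2_norm lborel (\<lambda>p. weyl (s *\<^sub>R (0, a)) (s *\<^sub>R (0, b)) (s * - m) H p - H p) \<le> \<bar>s\<bar> * X"
    (is "?N \<le> _")
proof (rule power2_le_imp_le)
  have "ennreal (?N\<^sup>2) \<le> ennreal (s\<^sup>2) * ennreal (X\<^sup>2)"
    using power2_L2_norm_weyl_diff_le[OF assms(1-3), of s a m c d] unfolding X(1) .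
  then show "?N\<^sup>2 \<le> (\<bar>s\<bar> * X)\<^sup>2"
    by (simp add: power_mult_distrib flip: ennreal_mult)
qed (simp add: X)

lemma snd_moment_eq_0D:
  fixes F :: "'a::euclidean_space \<times> real \<Rightarrow> complex"
  assumes [measurable]: "F \<in> borel_measurable borel" and "snd_moment m F = 0"
  shows "AE p in lborel. F p = 0"
proof -
  have "AE p in lborel. ennreal ((snd p - m)\<^sup>2 * (cmod (F p))\<^sup>2) = 0"
    using assms(2) unfolding snd_moment_def by (subst (asm) nn_integral_0_iff_AE) auto
  moreover have "AE p in (lborel :: ('a \<times> real) measure). snd p \<noteq> m"
    using AE_lborel_inner_neq[of "(0, 1) :: 'a \<times> real" m]
    by (simp add: Basis_prod_def inner_prod_def)
  ultimately show ?thesis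
    by eventually_elim auto
qed

lemma snd_moment_lct_snd_eq_0D:
  fixes H :: "'a::euclidean_space \<times> real \<Rightarrow> complex"
  assumes b: "b \<noteq> 0" and H: "H \<in> L2 lborel" "\<And>x. integrable lborel (\<lambda>\<tau>. H (x, \<tau>))"
    and "snd_moment m (lct_snd (a,b,c,d) H) = 0"
  shows "L2_norm lborel H = 0"
proof -
  note [measurable] = H(1)
  have "AE p in lborel. ennreal ((cmod (lct_snd (a,b,c,d) H p))\<^sup>2) = 0"
    using snd_moment_eq_0D[OF _ assms(4)] by simp
  then have "(\<integral>\<^sup>+p. ennreal ((cmod (lct_snd (a,b,c,d) H p))\<^sup>2) \<partial>lborel) = 0"
    by (subst nn_integral_0_iff_AE) auto
  then show ?thesis
    by (simp add: lct_snd_Plancherel[OF b H])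
qed

theorem lct_snd_uncertainty:
  fixes H :: "'a::euclidean_space \<times> real \<Rightarrow> complex"
  assumes b: "b1 \<noteq> 0" "b2 \<noteq> 0" and H: "H \<in> L2 lborel" "\<And>x. integrable lborel (\<lambda>\<tau>. H (x, \<tau>))"
  shows "ennreal ((a1*b2 - a2*b1)\<^sup>2 / 4 * ((L2_norm lborel H)\<^sup>2)\<^sup>2)
    \<le> snd_moment m (lct_snd (a1,b1,c1,d1) H) * snd_moment n (lct_snd (a2,b2,c2,d2) H)"
    (is "_ \<le> ?X * ?Y")
proof (cases "?X = 0 \<or> ?Y = 0") \<comment> \<open>treated first, because \<open>0 * \<infinity> = 0\<close>\<close>
  case True
  then have "L2_norm lborel H = 0"
    using snd_moment_lct_snd_eq_0D b H by blast
  then show ?thesis by simp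
next
  case nonzero: False
  show ?thesis
  proof (cases "?X = \<infinity> \<or> ?Y = \<infinity>")
    case True
    then have "?X * ?Y = \<infinity>"
      using nonzero by (auto simp: ennreal_mult_eq_top_iff)
    then show ?thesis by simp
  next
    case False
    then obtain x y where xy: "?X = ennreal (x\<^sup>2)" "0 \<le> x" "?Y = ennreal (y\<^sup>2)" "0 \<le> y"
      by (cases ?X; cases ?Y) (auto, metis real_sqrt_pow2 real_sqrt_ge_zero)
    have "\<bar>(0::'a, a1) \<bullet> (0, b2) - (0::'a, b1) \<bullet> (0, a2)\<bar> * (L2_norm lborel H)\<^sup>2 \<le> 2 * x * y"
      using L2_norm_weyl_diff_le[OF b(1) H xy(1,2)] L2_norm_weyl_diff_le[OF b(2) H xy(3,4)]
      by (rule weyl_uncertainty[OF H(1)])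
    then have "\<bar>a1*b2 - a2*b1\<bar> * (L2_norm lborel H)\<^sup>2 \<le> 2 * x * y"
      by (simp add: mult.commute)
    then have "(\<bar>a1*b2 - a2*b1\<bar> * (L2_norm lborel H)\<^sup>2)\<^sup>2 \<le> (2 * x * y)\<^sup>2"
      by (intro power_mono) auto
    then have "(a1*b2 - a2*b1)\<^sup>2 / 4 * ((L2_norm lborel H)\<^sup>2)\<^sup>2 \<le> x\<^sup>2 * y\<^sup>2"
      by (simp add: power_mult_distrib)
    then show ?thesis
      by (simp add: xy ennreal_leI flip: ennreal_mult)
  qed
qed

section \<open>The short-time transform\<close>

definition windowed :: "(real \<Rightarrow> complex) \<Rightarrow> (real \<Rightarrow> complex) \<Rightarrow> real \<times> real \<Rightarrow> complex" where
  "windowed g f p = f (snd p) * cnj (g (snd p - fst p))"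

lemma stlct_eq_lct_snd: "stlct M g f (fst p) (snd p) = lct_snd M (windowed g f) p"
  by (simp add: stlct_def lct_snd_def lct_integral_def windowed_def)

lemma freq_spread_eq_snd_moment:
  "freq_spread M g f
    = ennreal (1 / stlct_norm2 M g f) * snd_moment (mean_freq M g f) (lct_snd M (windowed g f))"
  by (simp only: freq_spread_def snd_moment_def stlct_eq_lct_snd lborel_prod)

lemma integrable_windowed_slice:
  assumes "f \<in> L2 lborel" "g \<in> L2 lborel"
  shows "integrable lborel (\<lambda>\<tau>. windowed g f (t, \<tau>))"
  using integrable_L2_mult_cnj[OF assms(1) L2_shift[OF assms(2), of "- t"]]
  by (simp add: windowed_def)

lemma borel_measurable_windowed [measurable]:
  assumes [measurable]: "f \<in> borel_measurable borel" "g \<in> borel_measurable borel"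
  shows "windowed g f \<in> borel_measurable borel"
proof -
  have "windowed g f \<in> borel_measurable (borel \<Otimes>\<^sub>M borel)"
    unfolding windowed_def[abs_def] by measurable
  then show ?thesis by (simp add: borel_prod)
qed

lemma nn_integral_windowed:
  assumes f: "f \<in> L2 lborel" and g: "g \<in> L2 lborel"
  shows "(\<integral>\<^sup>+p. ennreal ((cmod (windowed g f p))\<^sup>2) \<partial>lborel)
    = ennreal ((L2_norm lborel f * L2_norm lborel g)\<^sup>2)"
proof -
  have [measurable]: "f \<in> borel_measurable borel" "g \<in> borel_measurable borel"
    by (intro L2_lborel_measurable f g)+
  have "(\<integral>\<^sup>+p. ennreal ((cmod (windowed g f p))\<^sup>2) \<partial>lborel)
      = (\<integral>\<^sup>+\<tau>. (\<integral>\<^sup>+t. ennreal ((cmod (windowed g f (t, \<tau>)))\<^sup>2) \<partial>lborel) \<partial>lborel)"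
    using lborel_pair.nn_integral_snd[of "\<lambda>p. ennreal ((cmod (windowed g f p))\<^sup>2)"]
    by (simp add: lborel_prod)
  also have "\<dots> = (\<integral>\<^sup>+\<tau>. ennreal ((cmod (f \<tau>))\<^sup>2) *
      (\<integral>\<^sup>+t. ennreal ((cmod (g (\<tau> - t)))\<^sup>2) \<partial>lborel) \<partial>lborel)"
    by (simp add: windowed_def norm_mult power_mult_distrib ennreal_mult nn_integral_cmult)
  also have "\<dots> = (\<integral>\<^sup>+\<tau>. ennreal ((cmod (f \<tau>))\<^sup>2) * ennreal ((L2_norm lborel g)\<^sup>2) \<partial>lborel)"
    using nn_integral_real_affine[of "\<lambda>x. ennreal ((cmod (g x))\<^sup>2)" "-1"]
      nn_integral_eq_L2_norm[OF g] by simp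
  also have "\<dots> = ennreal ((L2_norm lborel f * L2_norm lborel g)\<^sup>2)"
    by (simp add: nn_integral_multc nn_integral_eq_L2_norm[OF f] power_mult_distrib ennreal_mult)
  finally show ?thesis .
qed

lemma L2_windowed:
  assumes "f \<in> L2 lborel" "g \<in> L2 lborel"
  shows "windowed g f \<in> L2 lborel"
  using nn_integral_windowed[OF assms] assms[THEN L2_measurable]
  by (simp add: L2_iff_nn_integral_finite)

lemma L2_norm_windowed:
  assumes "f \<in> L2 lborel" "g \<in> L2 lborel"
  shows "L2_norm lborel (windowed g f) = L2_norm lborel f * L2_norm lborel g"
  using nn_integral_windowed[OF assms] nn_integral_eq_L2_norm[OF L2_windowed[OF assms]]
  by (simp add: L2_norm_nonneg)

lemma stlct_norm2_eq:
  assumes "b \<noteq> 0" "f \<in> L2 lborel" "g \<in> L2 lborel"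
  shows "stlct_norm2 (a,b,c,d) g f = (L2_norm lborel (windowed g f))\<^sup>2"
  using lct_snd_Plancherel[OF assms(1) L2_windowed integrable_windowed_slice, OF assms(2,3,2,3)]
  by (simp add: stlct_norm2_def stlct_eq_lct_snd lborel_prod)

theorem theorem2:
  fixes a1 b1 c1 d1 a2 b2 c2 d2 :: real and f g :: "real \<Rightarrow> complex"
  assumes "a1*d1 - b1*c1 = 1" and "a2*d2 - b2*c2 = 1" and "b1 \<noteq> 0" and "b2 \<noteq> 0"
    and "square_integrable f" and "square_integrable g"
    and "\<not> (AE x in lborel. f x = 0)" and "\<not> (AE x in lborel. g x = 0)"
    and "\<exists>F. is_lct (a1,b1,c1,d1) f F \<and> square_integrable (\<lambda>u. complex_of_real u * F u)"
    and "\<exists>F. is_lct (a2,b2,c2,d2) f F \<and> square_integrable (\<lambda>u. complex_of_real u * F u)"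
    and "\<exists>G. is_lct (a1,b1,c1,d1) g G \<and> square_integrable (\<lambda>u. complex_of_real u * G u)"
    and "\<exists>G. is_lct (a2,b2,c2,d2) g G \<and> square_integrable (\<lambda>u. complex_of_real u * G u)"
  shows "freq_spread (a1,b1,c1,d1) g f * freq_spread (a2,b2,c2,d2) g f
           \<ge> ennreal ((a1*b2 - a2*b1)\<^sup>2 / 4)"
proof -
  have fg: "f \<in> L2 lborel" "g \<in> L2 lborel"
    using assms(5,6) by (simp_all add: square_integrable_def L2_def)
  define N where "N = L2_norm lborel (windowed g f)"
  let ?A = "(a1,b1,c1,d1)" and ?B = "(a2,b2,c2,d2)"
  let ?X = "snd_moment (mean_freq ?A g f) (lct_snd ?A (windowed g f))"
    and ?Y = "snd_moment (mean_freq ?B g f) (lct_snd ?B (windowed g f))"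
  have "0 < N"
    using L2_norm_pos[OF fg(1) assms(7)] L2_norm_pos[OF fg(2) assms(8)]
    by (simp add: N_def L2_norm_windowed[OF fg])
  then have "ennreal ((a1*b2 - a2*b1)\<^sup>2 / 4)
      = ennreal (1 / N\<^sup>2) * ennreal (1 / N\<^sup>2) * ennreal ((a1*b2 - a2*b1)\<^sup>2 / 4 * (N\<^sup>2)\<^sup>2)"
    by (simp add: power2_eq_square flip: ennreal_mult)
  also have "\<dots> \<le> ennreal (1 / N\<^sup>2) * ennreal (1 / N\<^sup>2) * (?X * ?Y)"
    unfolding N_def
    by (intro mult_left_mono lct_snd_uncertainty assms(3,4) L2_windowed integrable_windowed_slice fg)
       simp
  also have "\<dots> = freq_spread ?A g f * freq_spread ?B g f"
    unfolding freq_spread_eq_snd_moment stlct_norm2_eq[OF assms(3) fg] stlct_norm2_eq[OF assms(4) fg]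
      N_def[symmetric] by (simp only: mult_ac)
  finally show ?thesis .
qed

end
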